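(* Let $E=F'_c$, where $F$ is a separable Fréchet space with the approximation property. Let $L$ be a nontrivial convolution operator on $(\mathcal{H}(E),\tau_0)$. Then $L$ is mixing; in particular, $L$ is hypercyclic.
   Context: All locally convex spaces are complex and Hausdorff. $F'_c$ denotes the topological dual $F'$ of $F$ with the topology of uniform convergence on compact subsets of $F$. $\mathcal{H}(E)$ denotes the vector space of all holomorphic functions $f\colon E\to\mathbb{C}$, and $\tau_0$ is the compact-open topology. For $a\in E$ and $f\in\mathcal{H}(E)$ put $(\tau_a f)(x)=f(x-a)$. A convolution operator on $(\mathcal{H}(E),\tau_0)$ is a continuous linear mapping $L\colon\mathcal{H}(E)\to\mathcal{H}(E)$ such that $L(\tau_a f)=\tau_a(Lf)$ for all $f\in\mathcal{H}(E)$ and $a\in E$. It is nontrivial if it is not a scalar multiple of the identity. A continuous linear operator $T\colon X\to X$ on a topological vector space $X$ is mixing if for any two non-empty open sets $U,V\subset X$ there is $n_0\in\mathbb{N}$ such that $T^n(U)\cap V\neq\emptyset$ for all $n\geq n_0$. It is hypercyclic if there is $x\in X$ whose orbit $\{x,T(x),T^2(x),\ldots\}$ is dense in $X$. *)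

theory Defs
  imports "HOL-Analysis.Analysis"
begin

section \<open>Complex topological vector spaces\<close>

text \<open>The library has type classes for real vector spaces only.  Every complex vector space is
  a real one by restriction of scalars, and keeping \<^const>\<open>scaleR\<close> makes the library's convexity available.\<close>

class complex_vector = real_vector +
  fixes scaleC :: "complex \<Rightarrow> 'a \<Rightarrow> 'a"  (infixr \<open>*\<^sub>C\<close> 75)
  assumes scaleC_add_right: "c *\<^sub>C (x + y) = c *\<^sub>C x + c *\<^sub>C y"
    and scaleC_add_left: "(c + d) *\<^sub>C x = c *\<^sub>C x + d *\<^sub>C x"
    and scaleC_scaleC: "c *\<^sub>C d *\<^sub>C x = (c * d) *\<^sub>C x"
    and scaleC_one: "1 *\<^sub>C x = x"
    and scaleR_scaleC: "r *\<^sub>R x = complex_of_real r *\<^sub>C x"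

global_interpretation complex_vector: vector_space "scaleC :: complex \<Rightarrow> 'a \<Rightarrow> 'a::complex_vector"
  by unfold_locales (rule scaleC_add_right scaleC_add_left scaleC_scaleC scaleC_one)+

abbreviation clinear :: "('a::complex_vector \<Rightarrow> 'b::complex_vector) \<Rightarrow> bool"
  where "clinear \<equiv> Vector_Spaces.linear scaleC scaleC"

lemma clinear_iff:
  "clinear f \<longleftrightarrow> (\<forall>x y. f (x + y) = f x + f y) \<and> (\<forall>c x. f (c *\<^sub>C x) = c *\<^sub>C f x)"
  by (auto simp: Vector_Spaces.linear_def module_hom_def module_hom_axioms_def
      complex_vector.vector_space_axioms complex_vector.module_axioms)

class complex_lcs = complex_vector + topological_ab_group_add + t2_space +
  assumes tendsto_scaleC_Pair: "LIM p (nhds c \<times>\<^sub>F nhds x). fst p *\<^sub>C snd p :> nhds (c *\<^sub>C x)"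
    and locally_convex_raw: "open U \<Longrightarrow> 0 \<in> U \<Longrightarrow> \<exists>V. open V \<and>
      (\<forall>x\<in>V. \<forall>y\<in>V. \<forall>u\<ge>0. \<forall>v\<ge>0. u + v = 1 \<longrightarrow> u *\<^sub>R x + v *\<^sub>R y \<in> V) \<and> 0 \<in> V \<and> V \<subseteq> U"

text \<open>The class axiom spells out \<^const>\<open>convex\<close>, which cannot be used inside a class specification.\<close>

lemma locally_convex:
  "open U \<Longrightarrow> 0 \<in> U \<Longrightarrow> \<exists>V. open V \<and> convex V \<and> 0 \<in> V \<and> V \<subseteq> (U :: 'a::complex_lcs set)"
  unfolding convex_def by (rule locally_convex_raw)

text \<open>A Frechet space is a locally convex space whose topology is induced by a complete
  translation-invariant metric.  The choice of such a metric is irrelevant for all that follows: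
  only the topology of the space enters.\<close>

class complex_frechet = complex_lcs + complete_space +
  assumes dist_translation: "dist (x + z) (y + z) = dist x y"

definition approximation_property :: "'a::complex_lcs itself \<Rightarrow> bool"
  where "approximation_property _ \<longleftrightarrow>
    (\<forall>(K::'a set) U. compact K \<longrightarrow> open U \<longrightarrow> 0 \<in> U \<longrightarrow>
      (\<exists>T::'a \<Rightarrow> 'a. clinear T \<and> continuous_on UNIV T \<and>
        (\<exists>B. finite B \<and> range T \<subseteq> complex_vector.span B) \<and> (\<forall>x\<in>K. T x - x \<in> U)))"

instantiation complex :: complex_frechet
begin

definition scaleC_complex :: "complex \<Rightarrow> complex \<Rightarrow> complex"
  where [simp]: "scaleC_complex c z = c * z"

instance
proof
  fix c x :: complex and U :: "complex set"
  show "LIM p (nhds c \<times>\<^sub>F nhds x). fst p *\<^sub>C snd p :> nhds (c *\<^sub>C x)"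
    using tendsto_mult_Pair[of c x] by simp
  show "\<exists>V. open V \<and> (\<forall>x\<in>V. \<forall>y\<in>V. \<forall>u\<ge>0. \<forall>v\<ge>0. u + v = 1 \<longrightarrow> u *\<^sub>R x + v *\<^sub>R y \<in> V) \<and>
      0 \<in> V \<and> V \<subseteq> U" if "open U" "0 \<in> U"
    using that unfolding convex_def[symmetric] by (meson centre_in_ball convex_ball openE open_ball)
qed (simp_all add: algebra_simps scaleR_conv_of_real dist_norm)

end


section \<open>Topologies of uniform convergence on compact sets\<close>

text \<open>The function \<open>rep\<close> turns the elements of a space of functions into actual
  functions.  Finite unions of compact sets are compact, so the sets
  \<open>{g. \<forall>x\<in>K. cmod (rep g x - rep f x) < e}\<close> form a neighbourhood base at \<open>f\<close>.\<close>

definition compact_open :: "('a \<Rightarrow> 'x::topological_space \<Rightarrow> complex) \<Rightarrow> 'a set \<Rightarrow> bool"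
  where "compact_open rep U \<longleftrightarrow>
    (\<forall>f\<in>U. \<exists>K e. compact K \<and> 0 < e \<and> {g. \<forall>x\<in>K. cmod (rep g x - rep f x) < e} \<subseteq> U)"

lemma compact_open_UNIV: "compact_open rep UNIV"
  unfolding compact_open_def by (auto intro!: exI[of _ "{}"] exI[of _ "1::real"])

lemma compact_open_Int:
  assumes "compact_open rep S" "compact_open rep T"
  shows "compact_open rep (S \<inter> T)"
  unfolding compact_open_def
proof
  fix f assume "f \<in> S \<inter> T"
  then obtain K1 e1 K2 e2 where
    *: "compact K1" "0 < e1" "{g. \<forall>x\<in>K1. cmod (rep g x - rep f x) < e1} \<subseteq> S"
       "compact K2" "0 < e2" "{g. \<forall>x\<in>K2. cmod (rep g x - rep f x) < e2} \<subseteq> T"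
    using assms unfolding compact_open_def by (meson IntD1 IntD2)
  then show "\<exists>K e. compact K \<and> 0 < e \<and> {g. \<forall>x\<in>K. cmod (rep g x - rep f x) < e} \<subseteq> S \<inter> T"
    by (intro exI[of _ "K1 \<union> K2"] exI[of _ "min e1 e2"]) (auto simp: compact_Un)
qed

lemma compact_open_Union:
  assumes "\<forall>S\<in>\<K>. compact_open rep S"
  shows "compact_open rep (\<Union>\<K>)"
  unfolding compact_open_def
proof
  fix f assume "f \<in> \<Union>\<K>"
  then obtain S where S: "S \<in> \<K>" "f \<in> S" by blast
  with assms have "\<exists>K e. compact K \<and> 0 < e \<and> {g. \<forall>x\<in>K. cmod (rep g x - rep f x) < e} \<subseteq> S"
    unfolding compact_open_def by simp
  with S show "\<exists>K e. compact K \<and> 0 < e \<and> {g. \<forall>x\<in>K. cmod (rep g x - rep f x) < e} \<subseteq> \<Union>\<K>"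
    by (meson Union_upper order_trans)
qed

lemma compact_bound_strict:
  fixes h :: "'x::topological_space \<Rightarrow> complex"
  assumes "compact K" "continuous_on K h" "0 < e" "\<forall>x\<in>K. cmod (h x) < e"
  shows "\<exists>d. 0 < d \<and> (\<forall>x\<in>K. cmod (h x) + d < e)"
proof (cases "K = {}")
  case True
  then show ?thesis by (auto intro: exI[of _ "1::real"])
next
  case False
  have "continuous_on K (\<lambda>x. cmod (h x))"
    using assms by (intro continuous_intros)
  then obtain x where x: "x \<in> K" "\<forall>y\<in>K. cmod (h y) \<le> cmod (h x)"
    using continuous_attains_sup[OF assms(1) False] by blast
  have "cmod (h y) + (e - cmod (h x)) / 2 < e" if "y \<in> K" for y
    using x(2)[rule_format, OF that] assms(4)[rule_format, OF x(1)] by (simp add: field_simps)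
  then show ?thesis
    using x(1) assms(4) by (intro exI[of _ "(e - cmod (h x)) / 2"]) auto
qed

locale compact_open_space =
  fixes rep :: "'a::{complex_vector,topological_space} \<Rightarrow> 'x::topological_space \<Rightarrow> complex"
  assumes open_rep: "open U \<longleftrightarrow> compact_open rep U"
    and continuous_rep: "continuous_on UNIV (rep f)"
    and rep_inject: "rep f = rep g \<Longrightarrow> f = g"
    and rep_add: "rep (f + g) x = rep f x + rep g x"
    and rep_scaleC: "rep (c *\<^sub>C f) x = c * rep f x"
begin

lemma rep_uminus: "rep (- f) x = - rep f x"
  using rep_scaleC[of "-1" f x] by (simp add: complex_vector.scale_minus_left scaleC_one)

lemma rep_zero: "rep 0 x = 0"
  using rep_scaleC[of 0 0 x] by simp

lemma rep_scaleR: "rep (r *\<^sub>R f) x = complex_of_real r * rep f x"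
  by (simp add: scaleR_scaleC rep_scaleC)

lemma open_repE:
  assumes "open U" "f \<in> U"
  obtains K e where "compact K" "0 < e" "{g. \<forall>x\<in>K. cmod (rep g x - rep f x) < e} \<subseteq> U"
  using bspec[OF assms(1)[unfolded open_rep compact_open_def] assms(2)] that by (elim exE conjE)

lemma open_basic:
  assumes "compact K" "0 < e"
  shows "open {g. \<forall>x\<in>K. cmod (rep g x - rep f x) < e}"
  unfolding open_rep compact_open_def
proof
  fix h assume h: "h \<in> {g. \<forall>x\<in>K. cmod (rep g x - rep f x) < e}"
  have "continuous_on K (\<lambda>x. rep h x - rep f x)"
    using continuous_rep by (intro continuous_intros) (auto intro: continuous_on_subset)
  then obtain d where d: "0 < d" "\<forall>x\<in>K. cmod (rep h x - rep f x) + d < e"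
    using compact_bound_strict[OF assms(1) _ assms(2)] h by blast
  have "cmod (rep g x - rep f x) < e" if "\<forall>x\<in>K. cmod (rep g x - rep h x) < d" "x \<in> K" for g x
    using norm_triangle_ineq[of "rep g x - rep h x" "rep h x - rep f x"] d that by force
  with d assms show "\<exists>K' d. compact K' \<and> 0 < d \<and>
      {g. \<forall>x\<in>K'. cmod (rep g x - rep h x) < d} \<subseteq> {g. \<forall>x\<in>K. cmod (rep g x - rep f x) < e}"
    by blast
qed

lemma tendsto_rep_iff:
  "(F \<longlongrightarrow> f) G \<longleftrightarrow>
    (\<forall>K e. compact K \<longrightarrow> 0 < e \<longrightarrow> (\<forall>\<^sub>F t in G. \<forall>x\<in>K. cmod (rep (F t) x - rep f x) < e))"
  (is "_ \<longleftrightarrow> ?R")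
proof
  assume L: "(F \<longlongrightarrow> f) G"
  show ?R
  proof (intro allI impI)
    fix K :: "'x set" and e :: real assume "compact K" "0 < e"
    then show "\<forall>\<^sub>F t in G. \<forall>x\<in>K. cmod (rep (F t) x - rep f x) < e"
      using topological_tendstoD[OF L open_basic[of K e f]] by simp
  qed
next
  assume R: ?R
  show "(F \<longlongrightarrow> f) G"
  proof (rule topological_tendstoI)
    fix S assume "open S" "f \<in> S"
    then obtain K e where *: "compact K" "0 < e" "{g. \<forall>x\<in>K. cmod (rep g x - rep f x) < e} \<subseteq> S"
      by (rule open_repE)
    from R *(1,2) have "\<forall>\<^sub>F t in G. \<forall>x\<in>K. cmod (rep (F t) x - rep f x) < e" by simp
    then show "\<forall>\<^sub>F t in G. F t \<in> S"
      by eventually_elim (use *(3) in auto)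
  qed
qed

lemma eventually_basic:
  assumes "compact K" "0 < e"
  shows "\<forall>\<^sub>F h in nhds f. \<forall>x\<in>K. cmod (rep h x - rep f x) < e"
  using assms tendsto_rep_iff[of "\<lambda>x. x" f "nhds f"] filterlim_ident by blast

lemma tendsto_add_rep: "LIM p (nhds (f::'a) \<times>\<^sub>F nhds g). fst p + snd p :> nhds (f + g)"
  unfolding tendsto_rep_iff
proof (intro allI impI)
  fix K :: "'x set" and e :: real assume K: "compact K" "0 < e"
  have "\<forall>\<^sub>F h in nhds k. \<forall>x\<in>K. cmod (rep h x - rep k x) < e / 2" for k
    using K by (intro eventually_basic) auto
  from eventually_prodI[OF this[of f] this[of g]]
  show "\<forall>\<^sub>F p in nhds f \<times>\<^sub>F nhds g. \<forall>x\<in>K. cmod (rep (fst p + snd p) x - rep (f + g) x) < e"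
  proof (rule eventually_mono, safe)
    fix p x assume x: "x \<in> K" and *: "\<forall>x\<in>K. cmod (rep (fst p) x - rep f x) < e / 2"
      "\<forall>x\<in>K. cmod (rep (snd p) x - rep g x) < e / 2"
    have "rep (fst p + snd p) x - rep (f + g) x =
        (rep (fst p) x - rep f x) + (rep (snd p) x - rep g x)"
      by (simp add: rep_add)
    also have "cmod \<dots> < e" using norm_triangle_lt[of "rep (fst p) x - rep f x"] * x by force
    finally show "cmod (rep (fst p + snd p) x - rep (f + g) x) < e" .
  qed
qed

lemma tendsto_uminus_rep: "(uminus \<longlongrightarrow> - (f::'a)) (nhds f)"
  unfolding tendsto_rep_iff
proof (intro allI impI)
  fix K :: "'x set" and e :: real assume K: "compact K" "0 < e"
  have "\<forall>\<^sub>F h in nhds f. \<forall>x\<in>K. cmod (rep h x - rep f x) < e"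
    using K by (intro eventually_basic) auto
  then show "\<forall>\<^sub>F h in nhds f. \<forall>x\<in>K. cmod (rep (- h) x - rep (- f) x) < e"
    by (rule eventually_mono) (simp add: rep_uminus norm_minus_commute)
qed

lemma tendsto_scaleC_rep: "LIM p (nhds c \<times>\<^sub>F nhds (f::'a)). fst p *\<^sub>C snd p :> nhds (c *\<^sub>C f)"
  unfolding tendsto_rep_iff
proof (intro allI impI)
  fix K :: "'x set" and e :: real assume K: "compact K" "0 < e"
  have "bounded (rep f ` K)"
    using compact_continuous_image[OF continuous_on_subset[OF continuous_rep] K(1)]
    by (simp add: compact_imp_bounded)
  then obtain M where M: "M > 0" "\<forall>x\<in>K. cmod (rep f x) \<le> M"
    by (auto simp: bounded_pos)
  define d where "d = e / (2 * (cmod c + 1))"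
  define b where "b = min 1 (e / (2 * M))"
  have d: "d > 0" and b: "b > 0"
    using K M by (auto simp: d_def b_def add_nonneg_pos)
  have 1: "\<forall>\<^sub>F z in nhds c. cmod (z - c) < b"
    using b by (auto simp: eventually_nhds_metric dist_norm)
  have 2: "\<forall>\<^sub>F h in nhds f. \<forall>x\<in>K. cmod (rep h x - rep f x) < d"
    using K d by (intro eventually_basic) auto
  from eventually_prodI[OF 1 2]
  show "\<forall>\<^sub>F p in nhds c \<times>\<^sub>F nhds f. \<forall>x\<in>K. cmod (rep (fst p *\<^sub>C snd p) x - rep (c *\<^sub>C f) x) < e"
  proof (rule eventually_mono, safe)
    fix p x assume x: "x \<in> K" and *: "cmod (fst p - c) < b"
      "\<forall>x\<in>K. cmod (rep (snd p) x - rep f x) < d"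
    let ?z = "fst p" and ?h = "rep (snd p) x" and ?f = "rep f x"
    have "cmod ?z \<le> cmod c + 1"
      using norm_triangle_ineq[of "?z - c" c] * by (simp add: b_def)
    then have "cmod ?z * cmod (?h - ?f) \<le> (cmod c + 1) * cmod (?h - ?f)"
      by (rule mult_right_mono) simp
    also have "\<dots> < (cmod c + 1) * d"
      using * x by (intro mult_strict_left_mono) (auto simp: add_nonneg_pos)
    also have "\<dots> = e / 2"
    proof -
      have "N * (e / (2 * N)) = e / 2" if "N \<noteq> 0" for N :: real
        using that by simp
      moreover have "cmod c + 1 \<noteq> 0" using norm_ge_zero[of c] by linarith
      ultimately show ?thesis unfolding d_def by blast
    qed
    finally have A: "cmod (?z * (?h - ?f)) < e / 2" by (simp add: norm_mult)
    have "cmod (?z - c) * cmod ?f \<le> b * M"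
      using * x M b by (intro mult_mono) auto
    also have "\<dots> \<le> e / (2 * M) * M"
      using M by (intro mult_right_mono) (auto simp: b_def)
    also have "\<dots> = e / 2" using M by simp
    finally have B: "cmod ((?z - c) * ?f) \<le> e / 2" by (simp add: norm_mult)
    have "rep (fst p *\<^sub>C snd p) x - rep (c *\<^sub>C f) x = ?z * (?h - ?f) + (?z - c) * ?f"
      by (simp add: rep_scaleC algebra_simps)
    also have "cmod \<dots> < e"
      using norm_triangle_ineq[of "?z * (?h - ?f)" "(?z - c) * ?f"] A B by linarith
    finally show "cmod (rep (fst p *\<^sub>C snd p) x - rep (c *\<^sub>C f) x) < e" .
  qed
qed

lemma convex_basic_rep: "convex {g. \<forall>x\<in>K. cmod (rep g x - rep f x) < e}"
proof -
  have "convex {g. cmod (rep g x - rep f x) < e}" for x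
  proof (rule convexI)
    fix g h u v
    assume *: "g \<in> {g. cmod (rep g x - rep f x) < e}" "h \<in> {g. cmod (rep g x - rep f x) < e}"
      and uv: "0 \<le> u" "0 \<le> v" "u + v = (1::real)"
    have "rep g x \<in> ball (rep f x) e" "rep h x \<in> ball (rep f x) e"
      using * by (auto simp: dist_norm norm_minus_commute)
    then have "u *\<^sub>R rep g x + v *\<^sub>R rep h x \<in> ball (rep f x) e"
      using uv by (intro convexD[OF convex_ball])
    then show "u *\<^sub>R g + v *\<^sub>R h \<in> {g. cmod (rep g x - rep f x) < e}"
      by (simp add: rep_add rep_scaleR scaleR_conv_of_real dist_norm norm_minus_commute)
  qed
  moreover have "{g. \<forall>x\<in>K. cmod (rep g x - rep f x) < e} = (\<Inter>x\<in>K. {g. cmod (rep g x - rep f x) < e})"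
    by auto
  ultimately show ?thesis by (simp add: convex_INT)
qed

lemma locally_convex_rep:
  assumes "open U" "0 \<in> (U::'a set)"
  shows "\<exists>V. open V \<and> convex V \<and> 0 \<in> V \<and> V \<subseteq> U"
proof -
  obtain K e where *: "compact K" "0 < e" "{g. \<forall>x\<in>K. cmod (rep g x - rep 0 x) < e} \<subseteq> U"
    using assms by (rule open_repE)
  then show ?thesis
    by (intro exI[of _ "{g. \<forall>x\<in>K. cmod (rep g x - rep 0 x) < e}"])
      (simp add: open_basic convex_basic_rep)
qed

lemma hausdorff_rep:
  assumes "f \<noteq> (g::'a)"
  shows "\<exists>U V. open U \<and> open V \<and> f \<in> U \<and> g \<in> V \<and> U \<inter> V = {}"
proof -
  obtain x where x: "rep f x \<noteq> rep g x" using assms rep_inject by blast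
  define e where "e = cmod (rep f x - rep g x) / 2"
  have e: "0 < e" using x by (simp add: e_def)
  have "\<not> (cmod (rep h x - rep f x) < e \<and> cmod (rep h x - rep g x) < e)" for h
    using norm_triangle_ineq4[of "rep h x - rep g x" "rep h x - rep f x"] by (auto simp: e_def)
  then show ?thesis
    using e open_basic[of "{x}" e f] open_basic[of "{x}" e g]
    by (intro exI[of _ "{h. \<forall>x\<in>{x}. cmod (rep h x - rep f x) < e}"]
        exI[of _ "{h. \<forall>x\<in>{x}. cmod (rep h x - rep g x) < e}"]) auto
qed

end


section \<open>The dual with the topology of uniform convergence on compact sets\<close>

typedef (overloaded) ('f::complex_lcs) dual = "{\<phi> :: 'f \<Rightarrow> complex. clinear \<phi> \<and> continuous_on UNIV \<phi>}"
  morphisms dual_apply Abs_dual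
  by (rule exI[of _ "\<lambda>_. 0"]) (simp add: clinear_iff)

setup_lifting type_definition_dual

instantiation dual :: (complex_lcs) complex_vector
begin

lift_definition zero_dual :: "'a dual" is "\<lambda>_. 0"
  by (simp add: clinear_iff)

lift_definition plus_dual :: "'a dual \<Rightarrow> 'a dual \<Rightarrow> 'a dual" is "\<lambda>\<phi> \<psi> x. \<phi> x + \<psi> x"
  by (auto simp: clinear_iff algebra_simps intro!: continuous_intros)

lift_definition uminus_dual :: "'a dual \<Rightarrow> 'a dual" is "\<lambda>\<phi> x. - \<phi> x"
  by (auto simp: clinear_iff algebra_simps intro!: continuous_intros)

lift_definition minus_dual :: "'a dual \<Rightarrow> 'a dual \<Rightarrow> 'a dual" is "\<lambda>\<phi> \<psi> x. \<phi> x - \<psi> x"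
  by (auto simp: clinear_iff algebra_simps intro!: continuous_intros)

lift_definition scaleR_dual :: "real \<Rightarrow> 'a dual \<Rightarrow> 'a dual" is "\<lambda>r \<phi> x. complex_of_real r * \<phi> x"
  by (auto simp: clinear_iff algebra_simps intro!: continuous_intros)

lift_definition scaleC_dual :: "complex \<Rightarrow> 'a dual \<Rightarrow> 'a dual" is "\<lambda>c \<phi> x. c * \<phi> x"
  by (auto simp: clinear_iff algebra_simps intro!: continuous_intros)

instance
  by standard (transfer; auto simp: algebra_simps fun_eq_iff)+

end

instantiation dual :: (complex_lcs) topological_space
begin

definition open_dual :: "'a dual set \<Rightarrow> bool"
  where "open_dual = compact_open dual_apply"

instance
  by standard (simp_all add: open_dual_def compact_open_UNIV compact_open_Int compact_open_Union)

end

global_interpretation dual: compact_open_space "dual_apply :: 'a::complex_lcs dual \<Rightarrow> 'a \<Rightarrow> complex"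
proof
  fix \<phi> :: "'a dual"
  show "continuous_on UNIV (dual_apply \<phi>)" using dual_apply[of \<phi>] by blast
qed (simp_all only: open_dual_def dual_apply_inject plus_dual.rep_eq scaleC_dual.rep_eq)

instance dual :: (complex_lcs) complex_lcs
proof
  fix a b :: "'a dual" and c :: complex and U :: "'a dual set"
  show "LIM p (nhds a \<times>\<^sub>F nhds b). fst p + snd p :> nhds (a + b)"
    by (rule dual.tendsto_add_rep)
  show "(uminus \<longlongrightarrow> - a) (nhds a)"
    by (rule dual.tendsto_uminus_rep)
  show "LIM p (nhds c \<times>\<^sub>F nhds a). fst p *\<^sub>C snd p :> nhds (c *\<^sub>C a)"
    by (rule dual.tendsto_scaleC_rep)
  show "\<exists>U V. open U \<and> open V \<and> a \<in> U \<and> b \<in> V \<and> U \<inter> V = {}" if "a \<noteq> b"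
    using that by (rule dual.hausdorff_rep)
  show "\<exists>V. open V \<and> (\<forall>x\<in>V. \<forall>y\<in>V. \<forall>u\<ge>0. \<forall>v\<ge>0. u + v = 1 \<longrightarrow> u *\<^sub>R x + v *\<^sub>R y \<in> V) \<and>
      0 \<in> V \<and> V \<subseteq> U" if "open U" "0 \<in> U"
    using dual.locally_convex_rep[OF that] unfolding convex_def .
qed


section \<open>Entire functions with the compact-open topology\<close>

text \<open>Holomorphic means Gateaux holomorphic, i.e. holomorphic on every complex line, and continuous.\<close>

typedef (overloaded) ('e::complex_lcs) entire =
  "{f :: 'e \<Rightarrow> complex. (\<forall>a b. (\<lambda>z. f (a + z *\<^sub>C b)) holomorphic_on UNIV) \<and> continuous_on UNIV f}"
  morphisms entire_apply Abs_entire
  by (rule exI[of _ "\<lambda>_. 0"]) simp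

setup_lifting type_definition_entire

instantiation entire :: (complex_lcs) complex_vector
begin

lift_definition zero_entire :: "'a entire" is "\<lambda>_. 0"
  by simp

lift_definition plus_entire :: "'a entire \<Rightarrow> 'a entire \<Rightarrow> 'a entire" is "\<lambda>f g x. f x + g x"
  by (auto intro!: continuous_intros holomorphic_intros)

lift_definition uminus_entire :: "'a entire \<Rightarrow> 'a entire" is "\<lambda>f x. - f x"
  by (auto intro!: continuous_intros holomorphic_intros)

lift_definition minus_entire :: "'a entire \<Rightarrow> 'a entire \<Rightarrow> 'a entire" is "\<lambda>f g x. f x - g x"
  by (auto intro!: continuous_intros holomorphic_intros)

lift_definition scaleR_entire :: "real \<Rightarrow> 'a entire \<Rightarrow> 'a entire" is "\<lambda>r f x. complex_of_real r * f x"
  by (auto intro!: continuous_intros holomorphic_intros)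

lift_definition scaleC_entire :: "complex \<Rightarrow> 'a entire \<Rightarrow> 'a entire" is "\<lambda>c f x. c * f x"
  by (auto intro!: continuous_intros holomorphic_intros)

instance
  by standard (transfer; auto simp: algebra_simps fun_eq_iff)+

end

instantiation entire :: (complex_lcs) topological_space
begin

definition open_entire :: "'a entire set \<Rightarrow> bool"
  where "open_entire = compact_open entire_apply"

instance
  by standard (simp_all add: open_entire_def compact_open_UNIV compact_open_Int compact_open_Union)

end

global_interpretation entire: compact_open_space "entire_apply :: 'a::complex_lcs entire \<Rightarrow> 'a \<Rightarrow> complex"
proof
  fix f :: "'a entire"
  show "continuous_on UNIV (entire_apply f)" using entire_apply[of f] by blast
qed (simp_all only: open_entire_def entire_apply_inject plus_entire.rep_eq scaleC_entire.rep_eq)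

instance entire :: (complex_lcs) complex_lcs
proof
  fix a b :: "'a entire" and c :: complex and U :: "'a entire set"
  show "LIM p (nhds a \<times>\<^sub>F nhds b). fst p + snd p :> nhds (a + b)"
    by (rule entire.tendsto_add_rep)
  show "(uminus \<longlongrightarrow> - a) (nhds a)"
    by (rule entire.tendsto_uminus_rep)
  show "LIM p (nhds c \<times>\<^sub>F nhds a). fst p *\<^sub>C snd p :> nhds (c *\<^sub>C a)"
    by (rule entire.tendsto_scaleC_rep)
  show "\<exists>U V. open U \<and> open V \<and> a \<in> U \<and> b \<in> V \<and> U \<inter> V = {}" if "a \<noteq> b"
    using that by (rule entire.hausdorff_rep)
  show "\<exists>V. open V \<and> (\<forall>x\<in>V. \<forall>y\<in>V. \<forall>u\<ge>0. \<forall>v\<ge>0. u + v = 1 \<longrightarrow> u *\<^sub>R x + v *\<^sub>R y \<in> V) \<and>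
      0 \<in> V \<and> V \<subseteq> U" if "open U" "0 \<in> U"
    using entire.locally_convex_rep[OF that] unfolding convex_def .
qed

lift_definition translate :: "'e::complex_lcs \<Rightarrow> 'e entire \<Rightarrow> 'e entire" is "\<lambda>a f x. f (x - a)"
proof safe
  fix a b d :: 'e and f :: "'e \<Rightarrow> complex"
  assume "\<forall>a b. (\<lambda>z. f (a + z *\<^sub>C b)) holomorphic_on UNIV"
  then have "(\<lambda>z. f ((b - a) + z *\<^sub>C d)) holomorphic_on UNIV" by blast
  then show "(\<lambda>z. f (b + z *\<^sub>C d - a)) holomorphic_on UNIV" by (simp add: algebra_simps)
next
  fix a :: 'e and f :: "'e \<Rightarrow> complex"
  assume "continuous_on UNIV f"
  then show "continuous_on UNIV (\<lambda>x. f (x - a))"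
    by (rule continuous_on_compose2) (auto intro!: continuous_intros)
qed

definition convolution_operator :: "('e::complex_lcs entire \<Rightarrow> 'e entire) \<Rightarrow> bool"
  where "convolution_operator L \<longleftrightarrow>
    clinear L \<and> continuous_on UNIV L \<and> (\<forall>f a. L (translate a f) = translate a (L f))"

definition nontrivial_operator :: "('a::complex_vector \<Rightarrow> 'a) \<Rightarrow> bool"
  where "nontrivial_operator T \<longleftrightarrow> \<not> (\<exists>c. \<forall>x. T x = c *\<^sub>C x)"


section \<open>Linear dynamics\<close>

definition mixing :: "('a::complex_lcs \<Rightarrow> 'a) \<Rightarrow> bool"
  where "mixing T \<longleftrightarrow> (\<forall>U V. open U \<longrightarrow> open V \<longrightarrow> U \<noteq> {} \<longrightarrow> V \<noteq> {} \<longrightarrow>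
    (\<exists>n0::nat. \<forall>n\<ge>n0. (T ^^ n) ` U \<inter> V \<noteq> {}))"

definition hypercyclic :: "('a::complex_lcs \<Rightarrow> 'a) \<Rightarrow> bool"
  where "hypercyclic T \<longleftrightarrow> (\<exists>x. closure (range (\<lambda>n::nat. (T ^^ n) x)) = UNIV)"

end

theory Submission
  imports Defs "HOL-Complex_Analysis.Cauchy_Integral_Formula"
begin

text \<open>The argument is that of Godefroy and Shapiro.  Write \<open>E\<close> for the dual of \<open>F\<close>, and for
  \<open>x\<close> in \<open>F\<close> let \<open>e\<^sub>x\<close> be the entire function \<open>\<phi> \<mapsto> exp (\<phi> x)\<close> on \<open>E\<close>.  Translations multiply \<open>e\<^sub>x\<close>
  by scalars, so an operator \<open>L\<close> that commutes with them has every \<open>e\<^sub>x\<close> as an eigenvector; its eigenvalue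
  \<open>\<lambda> x\<close> is the \<^emph>\<open>symbol\<close> of \<open>L\<close> (\<open>convolution_operator_exp\<close>).  The symbol is continuous on \<open>F\<close> and
  entire on every complex line.  The exponentials span a dense subspace, so \<open>\<lambda>\<close> is not constant
  when \<open>L\<close> is nontrivial, and by Liouville both \<open>{|\<lambda>| < 1}\<close> and \<open>{|\<lambda>| > 1}\<close> are nonempty open sets.
  The iterates of \<open>L\<close> tend to \<open>0\<close> on combinations of the first kind of eigenvectors, and combinations
  of the second kind have backward orbits that tend to \<open>0\<close>.  If both kinds are dense, one can
  therefore move from near any function to near any other one by \<open>L ^^ n\<close>, for all large \<open>n\<close>.

  \<^emph>\<open>Density.\<close>  By the approximation property \<open>x\<close> is approximated by \<open>T x\<close>, uniformly on
  compact sets, with \<open>T\<close> of finite rank.  Transposing, an entire function \<open>f\<close> is approximated by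
  \<open>\<phi> \<mapsto> f (\<phi> \<circ> T)\<close>, which depends on finitely many coordinates \<open>\<phi> y\<close> only; Taylor
  expansion in one coordinate after the other puts it into the closed span of the exponentials
  (\<open>exponentials_dense\<close>).  The exponents \<open>x\<close> can be restricted to an open set: if \<open>e\<^bsub>x + t y\<^esub>\<close>
  is in a closed subspace for small \<open>t\<close>, then so are its Taylor coefficients in \<open>t\<close>, and hence
  \<open>e\<^bsub>x + t y\<^esub>\<close> for all \<open>t\<close>.  Both steps are instances of \<open>entire_curve_approximable\<close>.

  \<^emph>\<open>A hypercyclic vector.\<close>  A hypercyclic vector is the limit of a sequence of exponential sums, each of
  which moves its predecessor slightly so as to visit a further member of a countable dense set.
  That the limit is continuous on \<open>E\<close> has to be ensured.  To this end choose a dense sequence in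
  \<open>F\<close>, scale its members to a null sequence, and let \<open>C\<close> be the compact set that consists of this
  null sequence and \<open>0\<close>.  The sets \<open>dual_ball C r = {\<phi>. \<forall>x\<in>C. |\<phi> x| < r}\<close> are
  open, they exhaust \<open>E\<close>, each compact set is contained in one of them, and the dense sequence is
  bounded on each of them.  The Taylor argument above also works uniformly on these sets for the
  exponents in \<open>bounded_vectors C\<close>, and translation invariance makes \<open>L\<close> continuous
  for uniform convergence on them.  So every approximation in the construction
  is made uniformly on such sets (\<open>transitivity_step\<close>), and a function that is a uniform limit on
  every \<open>dual_ball C r\<close> is entire (\<open>entire_limit\<close>).\<close>

section \<open>Uniform approximation and Taylor coefficients\<close>

text \<open>The members are plain functions: the Taylor coefficients that will be shown to belong to such a closure
  are not known beforehand to be entire functions.\<close>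

definition uniformly_approximable ::
    "'x set set \<Rightarrow> ('x \<Rightarrow> complex) set \<Rightarrow> ('x \<Rightarrow> complex) set"
  where "uniformly_approximable \<K> A =
    {h. \<forall>K\<in>\<K>. \<forall>e>0. \<exists>g\<in>A. \<forall>x\<in>K. cmod (h x - g x) < e}"

lemma uniformly_approximableD:
  assumes "h \<in> uniformly_approximable \<K> A" "K \<in> \<K>" "0 < e"
  obtains g where "g \<in> A" "\<And>x. x \<in> K \<Longrightarrow> cmod (h x - g x) < e"
  using assms unfolding uniformly_approximable_def by blast

lemma uniformly_approximable_superset: "A \<subseteq> uniformly_approximable \<K> A"
  unfolding uniformly_approximable_def by (auto intro!: bexI)

lemma uniformly_approximable_trans:
  assumes "\<And>K e. K \<in> \<K> \<Longrightarrow> 0 < e \<Longrightarrow>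
    \<exists>g\<in>uniformly_approximable \<K> A. \<forall>x\<in>K. cmod (h x - g x) < e"
  shows "h \<in> uniformly_approximable \<K> A"
  unfolding uniformly_approximable_def
proof safe
  fix K and e :: real assume K: "K \<in> \<K>" and "0 < e"
  then obtain g where g: "g \<in> uniformly_approximable \<K> A" "\<And>x. x \<in> K \<Longrightarrow> cmod (h x - g x) < e / 2"
    using assms[OF K, of "e / 2"] by auto
  obtain k where k: "k \<in> A" "\<And>x. x \<in> K \<Longrightarrow> cmod (g x - k x) < e / 2"
    using uniformly_approximableD[OF g(1) K, of "e / 2"] \<open>0 < e\<close> by auto
  have "cmod (h x - k x) < e" if "x \<in> K" for x
    using norm_diff_triangle_less[OF g(2)[OF that] k(2)[OF that]] by simp
  then show "\<exists>g\<in>A. \<forall>x\<in>K. cmod (h x - g x) < e" using k(1) by blast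
qed

lemma uniformly_approximable_mono:
  assumes "\<And>K. K \<in> \<K> \<Longrightarrow> \<exists>K'\<in>\<K>'. K \<subseteq> K'" and h: "h \<in> uniformly_approximable \<K>' A"
  shows "h \<in> uniformly_approximable \<K> A"
  unfolding uniformly_approximable_def
proof safe
  fix K and e :: real assume "K \<in> \<K>" and e: "0 < e"
  then obtain K' where K': "K' \<in> \<K>'" "K \<subseteq> K'" using assms(1) by blast
  obtain g where "g \<in> A" "\<And>x. x \<in> K' \<Longrightarrow> cmod (h x - g x) < e"
    using uniformly_approximableD[OF h K'(1) e] by blast
  then show "\<exists>g\<in>A. \<forall>x\<in>K. cmod (h x - g x) < e" using K'(2) by blast
qed

lemma approximable_imageE:
  assumes "h \<in> uniformly_approximable \<K> (F ` S)" "K \<in> \<K>" "0 < e"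
  obtains v where "v \<in> S" "\<And>x. x \<in> K \<Longrightarrow> cmod (h x - F v x) < e"
proof -
  obtain g where g: "g \<in> F ` S" "\<And>x. x \<in> K \<Longrightarrow> cmod (h x - g x) < e"
    using uniformly_approximableD[OF assms] by blast
  from g(1) obtain v where "v \<in> S" "g = F v" by blast
  with g(2) that show thesis by simp
qed

definition function_subspace :: "('x \<Rightarrow> complex) set \<Rightarrow> bool"
  where "function_subspace A \<longleftrightarrow> (\<lambda>_. 0) \<in> A \<and> (\<forall>f\<in>A. \<forall>g\<in>A. (\<lambda>x. f x + g x) \<in> A) \<and>
    (\<forall>c. \<forall>f\<in>A. (\<lambda>x. c * f x) \<in> A)"

lemma function_subspace_zero: "function_subspace A \<Longrightarrow> (\<lambda>_. 0) \<in> A"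
  by (simp add: function_subspace_def)

lemma function_subspace_add:
  "function_subspace A \<Longrightarrow> f \<in> A \<Longrightarrow> g \<in> A \<Longrightarrow> (\<lambda>x. f x + g x) \<in> A"
  by (simp add: function_subspace_def)

lemma function_subspace_scale:
  "function_subspace A \<Longrightarrow> f \<in> A \<Longrightarrow> (\<lambda>x. c * f x) \<in> A"
  by (simp add: function_subspace_def)

lemma function_subspace_diff:
  assumes "function_subspace A" "f \<in> A" "g \<in> A"
  shows "(\<lambda>x. f x - g x) \<in> A"
  using function_subspace_add[OF assms(1,2) function_subspace_scale[OF assms(1,3), of "-1"]] by simp

lemma function_subspace_sum:
  assumes "function_subspace A" "\<And>i. i \<in> I \<Longrightarrow> f i \<in> A"
  shows "(\<lambda>x. \<Sum>i\<in>I. f i x) \<in> A"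
  using assms(2)
  by (induction I rule: infinite_finite_induct)
    (use assms(1) in \<open>auto intro: function_subspace_add simp: function_subspace_def\<close>)

lemma function_subspace_uniformly_approximable:
  assumes A: "function_subspace A"
  shows "function_subspace (uniformly_approximable \<K> A)"
  unfolding function_subspace_def
proof (intro conjI ballI allI)
  show "(\<lambda>_. 0) \<in> uniformly_approximable \<K> A"
    using A uniformly_approximable_superset[of A] by (auto simp: function_subspace_def)
next
  fix f g assume fg: "f \<in> uniformly_approximable \<K> A" "g \<in> uniformly_approximable \<K> A"
  show "(\<lambda>x. f x + g x) \<in> uniformly_approximable \<K> A"
    unfolding uniformly_approximable_def
  proof safe
    fix K and e :: real assume K: "K \<in> \<K>" and "0 < e"
    then have e2: "0 < e / 2" by simp
    obtain f' where f': "f' \<in> A" "\<And>x. x \<in> K \<Longrightarrow> cmod (f x - f' x) < e / 2"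
      using uniformly_approximableD[OF fg(1) K e2] by blast
    obtain g' where g': "g' \<in> A" "\<And>x. x \<in> K \<Longrightarrow> cmod (g x - g' x) < e / 2"
      using uniformly_approximableD[OF fg(2) K e2] by blast
    have "cmod (f x + g x - (f' x + g' x)) < e" if "x \<in> K" for x
      using norm_diff_triangle_ineq[of "f x" "g x" "f' x" "g' x"] f'(2)[OF that] g'(2)[OF that] by simp
    then show "\<exists>h\<in>A. \<forall>x\<in>K. cmod (f x + g x - h x) < e"
      using function_subspace_add[OF A f'(1) g'(1)] by (intro bexI) auto
  qed
next
  fix c f assume f: "f \<in> uniformly_approximable \<K> A"
  show "(\<lambda>x. c * f x) \<in> uniformly_approximable \<K> A"
    unfolding uniformly_approximable_def
  proof safe
    fix K and e :: real assume K: "K \<in> \<K>" and "0 < e"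
    then have pos: "0 < e / (cmod c + 1)" by (simp add: add_nonneg_pos)
    obtain f' where f': "f' \<in> A" "\<And>x. x \<in> K \<Longrightarrow> cmod (f x - f' x) < e / (cmod c + 1)"
      using uniformly_approximableD[OF f K pos] by blast
    have "cmod (c * f x - c * f' x) < e" if "x \<in> K" for x
    proof -
      have "cmod (c * f x - c * f' x) = cmod c * cmod (f x - f' x)"
        by (metis norm_mult right_diff_distrib)
      also have "\<dots> \<le> cmod c * (e / (cmod c + 1))"
        using f'(2)[OF that] by (intro mult_left_mono) auto
      also have "\<dots> < e"
        using \<open>0 < e\<close> norm_ge_zero[of c] by (simp add: divide_less_eq algebra_simps del: norm_ge_zero)
      finally show ?thesis .
    qed
    then show "\<exists>h\<in>A. \<forall>x\<in>K. cmod (c * f x - h x) < e"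
      using function_subspace_scale[OF A f'(1)] by (intro bexI) auto
  qed
qed

definition taylor_coeff :: "(complex \<Rightarrow> complex) \<Rightarrow> nat \<Rightarrow> complex"
  where "taylor_coeff g n = (deriv ^^ n) g 0 / fact n"

text \<open>Cauchy's inequalities bound the tail of the Taylor series by a geometric series of
  ratio at most \<open>1 / 2\<close>.\<close>

lemma taylor_remainder_bound:
  assumes g: "g holomorphic_on UNIV" and bound: "\<And>z. cmod z \<le> R \<Longrightarrow> cmod (g z) \<le> M"
    and R: "0 < R" and w: "cmod w \<le> R / 2"
  shows "cmod (g w - (\<Sum>k<n. taylor_coeff g k * w ^ k)) \<le> 2 * M * (cmod w / R) ^ n"
proof -
  have "w \<in> ball 0 R" using w R by auto
  then have "(\<lambda>n. taylor_coeff g n * w ^ n) sums g w"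
    using holomorphic_power_series[OF holomorphic_on_subset[OF g], of 0 R w]
    by (simp add: taylor_coeff_def)
  then have tail: "(\<lambda>k. taylor_coeff g (k + n) * w ^ (k + n)) sums
      (g w - (\<Sum>k<n. taylor_coeff g k * w ^ k))"
    by (rule sums_split_initial_segment)
  have coeff: "cmod (taylor_coeff g k) \<le> M / R ^ k" for k
  proof -
    have "cmod ((deriv ^^ k) g 0) \<le> fact k * M / R ^ k"
      using bound R
      by (intro Cauchy_inequality holomorphic_on_subset[OF g] holomorphic_on_imp_continuous_on) auto
    then show ?thesis by (simp add: taylor_coeff_def norm_divide field_simps)
  qed
  have M: "0 \<le> M" using order_trans[OF norm_ge_zero bound[of 0]] R by simp
  have "cmod (taylor_coeff g (k + n) * w ^ (k + n)) \<le> M * (cmod w / R) ^ n * (1 / 2) ^ k" for k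
  proof -
    have "cmod (taylor_coeff g (k + n) * w ^ (k + n)) \<le> M / R ^ (k + n) * cmod w ^ (k + n)"
      unfolding norm_mult norm_power by (intro mult_right_mono coeff) auto
    also have "\<dots> = M * (cmod w / R) ^ n * (cmod w / R) ^ k"
      by (simp add: power_add power_divide mult.commute)
    also have "\<dots> \<le> M * (cmod w / R) ^ n * (1 / 2) ^ k"
      using w R M by (intro mult_left_mono power_mono) (auto simp: field_simps)
    finally show ?thesis .
  qed
  moreover have "(\<lambda>k. M * (cmod w / R) ^ n * (1 / 2) ^ k) sums (M * (cmod w / R) ^ n * 2)"
    using sums_mult[OF geometric_sums[of "1 / 2 :: real"], of "M * (cmod w / R) ^ n"] by simp
  ultimately have "cmod (g w - (\<Sum>k<n. taylor_coeff g k * w ^ k)) \<le> M * (cmod w / R) ^ n * 2"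
    by (intro norm_sums_le[OF tail])
  then show ?thesis by (simp add: algebra_simps)
qed

text \<open>The coefficient \<open>a\<^sub>n\<close> is the limit of \<open>(G t - (\<Sum>k<n. t ^ k * a\<^sub>k)) / t ^ n\<close> as \<open>t\<close> tends to \<open>0\<close>,
  uniformly on the sets of \<open>\<K>\<close> by the remainder bound.  So every coefficient lies in the closed
  span of the values \<open>G t\<close> with small \<open>t\<close>, by induction on \<open>n\<close>.\<close>

lemma taylor_coeff_approximable:
  assumes A: "function_subspace A"
    and hol: "\<And>x. (\<lambda>z. G z x) holomorphic_on UNIV"
    and bound: "\<And>K R. K \<in> \<K> \<Longrightarrow> \<exists>M. \<forall>x\<in>K. \<forall>z. cmod z \<le> R \<longrightarrow> cmod (G z x) \<le> M"
    and r: "0 < r" and mem: "\<And>t. cmod t < r \<Longrightarrow> G t \<in> uniformly_approximable \<K> A"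
  shows "(\<lambda>x. taylor_coeff (\<lambda>z. G z x) n) \<in> uniformly_approximable \<K> A"
proof (induction n rule: less_induct)
  case (less n)
  note sub = function_subspace_uniformly_approximable[OF A, of \<K>]
  show ?case
  proof (rule uniformly_approximable_trans)
    fix K and e :: real assume K: "K \<in> \<K>" and e: "0 < e"
    obtain M0 where M0: "\<And>x z. x \<in> K \<Longrightarrow> cmod z \<le> 1 \<Longrightarrow> cmod (G z x) \<le> M0"
      using bound[OF K, of 1] by blast
    define M where "M = max 1 M0"
    have M: "M > 0" "\<And>x z. x \<in> K \<Longrightarrow> cmod z \<le> 1 \<Longrightarrow> cmod (G z x) \<le> M"
      using M0 by (auto simp: M_def le_max_iff_disj)
    \<comment> \<open>small enough for \<open>G t\<close> to be approximable, for the remainder bound on the disc of radius \<open>1\<close>, and for an error below \<open>e\<close>\<close>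
    define s where "s = min (r / 2) (min (1 / 2) (e / (4 * M)))"
    have s: "0 < s" "s < r" "s \<le> 1 / 2" "2 * M * s < e"
    proof -
      show "0 < s" "s < r" "s \<le> 1 / 2" using r e M(1) by (auto simp: s_def)
      have "2 * M * s \<le> 2 * M * (e / (4 * M))"
        using M(1) by (intro mult_left_mono) (auto simp: s_def)
      then show "2 * M * s < e" using M(1) e by simp
    qed
    define t where "t = complex_of_real s"
    have t: "cmod t = s" "t \<noteq> 0" using s(1) by (auto simp: t_def)
    define g where "g = (\<lambda>x. inverse (t ^ n) *
      (G t x - (\<Sum>k<n. t ^ k * taylor_coeff (\<lambda>z. G z x) k)))"
    have "g \<in> uniformly_approximable \<K> A"
      unfolding g_def using mem[of t] t s(2) less
      by (intro function_subspace_scale[OF sub] function_subspace_diff[OF sub]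
          function_subspace_sum[OF sub]) auto
    moreover have "cmod (taylor_coeff (\<lambda>z. G z x) n - g x) < e" if "x \<in> K" for x
    proof -
      let ?c = "taylor_coeff (\<lambda>z. G z x)"
      have "?c n - g x = - inverse (t ^ n) * (G t x - (\<Sum>k<Suc n. ?c k * t ^ k))"
        using t(2) by (simp add: g_def field_simps)
      then have "cmod (?c n - g x) = inverse (s ^ n) * cmod (G t x - (\<Sum>k<Suc n. ?c k * t ^ k))"
        by (simp only: norm_mult norm_minus_cancel norm_inverse norm_power t(1))
      also have "\<dots> \<le> inverse (s ^ n) * (2 * M * (cmod t / 1) ^ Suc n)"
        using M(2) that s t by (intro mult_left_mono taylor_remainder_bound[OF hol]) auto
      also have "\<dots> = 2 * M * s" using s(1) t(1) by (simp add: field_simps)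
      finally show ?thesis using s(4) by linarith
    qed
    ultimately show "\<exists>g\<in>uniformly_approximable \<K> A. \<forall>x\<in>K. cmod (taylor_coeff (\<lambda>z. G z x) n - g x) < e"
      by blast
  qed
qed

text \<open>Expand \<open>G (u x) x\<close> in powers of \<open>u x\<close>.  For a constant \<open>u\<close> this extends the
  membership of \<open>G t\<close> from small \<open>t\<close> to all \<open>t\<close>; for a coordinate function \<open>u\<close> it adds one more
  variable to functions of finitely many coordinates.\<close>

lemma entire_curve_approximable:
  assumes A: "function_subspace A"
    and hol: "\<And>x. (\<lambda>z. G z x) holomorphic_on UNIV"
    and bound: "\<And>K R. K \<in> \<K> \<Longrightarrow> \<exists>M. \<forall>x\<in>K. \<forall>z. cmod z \<le> R \<longrightarrow> cmod (G z x) \<le> M"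
    and r: "0 < r" and mem: "\<And>t. cmod t < r \<Longrightarrow> G t \<in> uniformly_approximable \<K> A"
    and u_bound: "\<And>K. K \<in> \<K> \<Longrightarrow> \<exists>M. \<forall>x\<in>K. cmod (u x) \<le> M"
    and u_mult: "\<And>h. h \<in> uniformly_approximable \<K> A \<Longrightarrow> (\<lambda>x. u x * h x) \<in> uniformly_approximable \<K> A"
  shows "(\<lambda>x. G (u x) x) \<in> uniformly_approximable \<K> A"
proof (rule uniformly_approximable_trans)
  fix K and e :: real assume K: "K \<in> \<K>" and e: "0 < e"
  note sub = function_subspace_uniformly_approximable[OF A, of \<K>]
  obtain B0 where B0: "\<And>x. x \<in> K \<Longrightarrow> cmod (u x) \<le> B0" using u_bound[OF K] by blast
  \<comment> \<open>twice a bound for \<open>u\<close>, so that the remainders decay like \<open>(1 / 2) ^ N\<close>\<close>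
  define R where "R = 2 * max 1 B0"
  have R: "0 < R" "\<And>x. x \<in> K \<Longrightarrow> cmod (u x) \<le> R / 2" using B0 by (auto simp: R_def le_max_iff_disj)
  obtain M0 where M0: "\<And>x z. x \<in> K \<Longrightarrow> cmod z \<le> R \<Longrightarrow> cmod (G z x) \<le> M0"
    using bound[OF K, of R] by blast
  define M where "M = max 1 M0"
  have M: "M > 0" "\<And>x z. x \<in> K \<Longrightarrow> cmod z \<le> R \<Longrightarrow> cmod (G z x) \<le> M"
    using M0 by (auto simp: M_def le_max_iff_disj)
  obtain N where N: "(1 / 2) ^ N < e / (2 * M)"
    using real_arch_pow_inv[of "e / (2 * M)" "1 / 2"] e M(1) by auto
  define g where "g = (\<lambda>x. \<Sum>k<N. taylor_coeff (\<lambda>z. G z x) k * u x ^ k)"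
  have "(\<lambda>x. taylor_coeff (\<lambda>z. G z x) k * u x ^ j) \<in> uniformly_approximable \<K> A" for k j
  proof (induction j)
    case 0
    then show ?case using taylor_coeff_approximable[OF A hol bound r mem] by simp
  next
    case (Suc j)
    then show ?case using u_mult[OF Suc] by (simp add: algebra_simps)
  qed
  then have "g \<in> uniformly_approximable \<K> A"
    unfolding g_def by (intro function_subspace_sum[OF sub])
  moreover have "cmod (G (u x) x - g x) < e" if "x \<in> K" for x
  proof -
    have "cmod (G (u x) x - g x) \<le> 2 * M * (cmod (u x) / R) ^ N"
      unfolding g_def using M(2) that R by (intro taylor_remainder_bound[OF hol]) auto
    also have "\<dots> \<le> 2 * M * (1 / 2) ^ N"
      using R(2)[OF that] R(1) M(1) by (intro mult_left_mono power_mono) (auto simp: field_simps)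
    also have "\<dots> < e" using N M(1) by (simp add: field_simps)
    finally show ?thesis .
  qed
  ultimately show "\<exists>g\<in>uniformly_approximable \<K> A. \<forall>x\<in>K. cmod (G (u x) x - g x) < e" by blast
qed

section \<open>The dual of a locally convex space\<close>

lemma (in compact_open_space) tendsto_evaluation:
  assumes "(F \<longlongrightarrow> f) G"
  shows "((\<lambda>t. rep (F t) x) \<longlongrightarrow> rep f x) G"
  unfolding tendsto_iff dist_norm
proof (intro allI impI)
  fix e :: real assume "0 < e"
  then have "\<forall>\<^sub>F t in G. \<forall>y\<in>{x}. cmod (rep (F t) y - rep f y) < e"
    using assms unfolding tendsto_rep_iff by (meson compact_sing)
  then show "\<forall>\<^sub>F t in G. cmod (rep (F t) x - rep f x) < e" by simp
qed

lemma (in compact_open_space) rep_diff: "rep (f - g) x = rep f x - rep g x"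
  using rep_add[of f "- g" x] by (simp add: rep_uminus)

lemma dual_linear:
  "dual_apply \<phi> (x + y) = dual_apply \<phi> x + dual_apply \<phi> y"
  "dual_apply \<phi> (c *\<^sub>C x) = c * dual_apply \<phi> x"
  using dual_apply[of \<phi>] by (auto simp: clinear_iff)

lemma dual_zero: "dual_apply \<phi> 0 = 0"
  using dual_linear(1)[of \<phi> 0 0] by simp

lemma dual_diff: "dual_apply \<phi> (x - y) = dual_apply \<phi> x - dual_apply \<phi> y"
  using dual_linear(1)[of \<phi> "x - y" y] by simp

lemma dual_continuous: "continuous_on UNIV (dual_apply \<phi>)"
  using dual_apply[of \<phi>] by auto

lemma tendsto_scaleC:
  fixes g :: "'a \<Rightarrow> 'b::complex_lcs"
  assumes "(f \<longlongrightarrow> c) F" "(g \<longlongrightarrow> x) F"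
  shows "((\<lambda>t. f t *\<^sub>C g t) \<longlongrightarrow> c *\<^sub>C x) F"
  using filterlim_compose[OF tendsto_scaleC_Pair filterlim_Pair[OF assms]] by simp

lemma continuous_on_scaleC:
  fixes g :: "'a::topological_space \<Rightarrow> 'b::complex_lcs"
  assumes "continuous_on S f" "continuous_on S g"
  shows "continuous_on S (\<lambda>t. f t *\<^sub>C g t)"
  using assms unfolding continuous_on_def by (auto intro: tendsto_scaleC)

lemma continuous_on_evaluation: "continuous_on S (\<lambda>\<phi>. dual_apply \<phi> x)"
  unfolding continuous_on_def by (auto intro: dual.tendsto_evaluation tendsto_ident_at)

lemma compact_dual_bounded:
  assumes "compact K"
  shows "\<exists>M. \<forall>\<phi>\<in>K. cmod (dual_apply \<phi> x) \<le> M"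
  using compact_imp_bounded[OF compact_continuous_image[OF continuous_on_evaluation assms, of x]]
  by (auto simp: bounded_iff)

text \<open>Sequences of this kind serve as test sets in \<open>F\<close>, both for equicontinuity and for the
  compact set that defines the exhaustion of the dual.\<close>

lemma compact_sequence_insert_limit:
  fixes s :: "nat \<Rightarrow> 'a::metric_space"
  assumes "s \<longlonglongrightarrow> l"
  shows "compact (insert l (range s))"
proof (rule compactI)
  fix \<C> assume *: "\<forall>c\<in>\<C>. open c" "insert l (range s) \<subseteq> \<Union>\<C>"
  then obtain U where U: "U \<in> \<C>" "l \<in> U" by auto
  have "eventually (\<lambda>n. s n \<in> U) sequentially"
    using topological_tendstoD[OF assms] * U by blast
  then obtain N where N: "\<And>n. n \<ge> N \<Longrightarrow> s n \<in> U" by (auto simp: eventually_sequentially)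
  have "\<exists>V\<in>\<C>. s n \<in> V" for n using *(2) by (meson UnionE insert_subset range_subsetD)
  then obtain V where V: "\<And>n. V n \<in> \<C>" "\<And>n. s n \<in> V n" by metis
  show "\<exists>C'\<subseteq>\<C>. finite C' \<and> insert l (range s) \<subseteq> \<Union>C'"
  proof (intro exI[of _ "insert U (V ` {..<N})"] conjI)
    show "insert l (range s) \<subseteq> \<Union> (insert U (V ` {..<N}))"
    proof -
      have "s n \<in> \<Union> (insert U (V ` {..<N}))" for n
        using N[of n] V(2)[of n] by (cases "n < N") auto
      then show ?thesis using U(2) by blast
    qed
  qed (use U V in auto)
qed

text \<open>Otherwise some \<open>\<phi>\<^sub>n \<in> K\<close> are at least \<open>d\<close> in modulus at points \<open>u\<^sub>n\<close> of a null sequence.  That sequence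
  with its limit is a compact set \<open>C\<close>, and up to \<open>d / 2\<close> on \<open>C\<close> the set \<open>K\<close> consists of finitely many
  functionals; each of these is small at \<open>u\<^sub>n\<close> for large \<open>n\<close>.\<close>

lemma compact_dual_equicontinuous:
  fixes K :: "'f::{complex_lcs,metric_space} dual set"
  assumes K: "compact K" and d: "0 < d"
  shows "\<exists>\<eta>>0. \<forall>x\<in>ball 0 \<eta>. \<forall>\<phi>\<in>K. cmod (dual_apply \<phi> x) < d"
proof (rule ccontr)
  assume neg: "\<not> ?thesis"
  have "\<exists>x \<phi>. dist 0 x < inverse (Suc n) \<and> \<phi> \<in> K \<and> d \<le> cmod (dual_apply \<phi> x)" for n
  proof (rule ccontr)
    assume none: "\<not> ?thesis"
    have "\<forall>x\<in>ball 0 (inverse (real (Suc n))). \<forall>\<phi>\<in>K. cmod (dual_apply \<phi> x) < d"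
    proof (intro ballI)
      fix x :: 'f and \<phi> :: "'f dual" assume "x \<in> ball 0 (inverse (real (Suc n)))" "\<phi> \<in> K"
      then show "cmod (dual_apply \<phi> x) < d"
        using none unfolding mem_ball by (meson linorder_not_less)
    qed
    moreover have "0 < inverse (real (Suc n))" by simp
    ultimately show False using neg by blast
  qed
  then obtain u \<phi> where u: "\<And>n. dist 0 (u n) < inverse (Suc n)"
    and \<phi>: "\<And>n. \<phi> n \<in> K" "\<And>n. d \<le> cmod (dual_apply (\<phi> n) (u n))" by metis
  have lim: "u \<longlonglongrightarrow> 0"
    unfolding tendsto_iff
  proof safe
    fix e :: real assume "0 < e"
    show "\<forall>\<^sub>F n in sequentially. dist (u n) 0 < e"
      using order_tendstoD(2)[OF LIMSEQ_inverse_real_of_nat \<open>0 < e\<close>]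
      by eventually_elim (use u less_trans in \<open>simp add: dist_commute, blast\<close>)
  qed
  define C where "C = insert 0 (range u)"
  have C: "compact C" unfolding C_def by (rule compact_sequence_insert_limit[OF lim])
  define N where "N = (\<lambda>\<psi>. {\<phi>. \<forall>x\<in>C. cmod (dual_apply \<phi> x - dual_apply \<psi> x) < d / 2})"
  have N_open: "open (N \<psi>)" for \<psi>
    unfolding N_def using d by (intro dual.open_basic[OF C]) simp
  have "\<psi> \<in> N \<psi>" for \<psi> using d by (simp add: N_def)
  then have cover: "K \<subseteq> (\<Union>\<psi>\<in>K. N \<psi>)" by blast
  obtain K' where K': "K' \<subseteq> K" "finite K'" "K \<subseteq> (\<Union>\<psi>\<in>K'. N \<psi>)"
    using compactE_image[OF K _ cover] N_open by metis
  have small: "\<forall>\<^sub>F n in sequentially. cmod (dual_apply \<psi> (u n)) < d / 2" for \<psi>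
  proof -
    have "(\<lambda>n. dual_apply \<psi> (u n)) \<longlonglongrightarrow> dual_apply \<psi> 0"
      by (rule continuous_on_tendsto_compose[OF dual_continuous lim]) auto
    then show ?thesis
      using tendstoD[of _ _ _ "d / 2"] d by (fastforce simp: dual_zero)
  qed
  have "\<forall>\<^sub>F n in sequentially. \<forall>\<psi>\<in>K'. cmod (dual_apply \<psi> (u n)) < d / 2"
    using K'(2) small by (simp add: eventually_ball_finite)
  then obtain n where n: "\<And>\<psi>. \<psi> \<in> K' \<Longrightarrow> cmod (dual_apply \<psi> (u n)) < d / 2"
    by (auto simp: eventually_sequentially)
  obtain \<psi> where \<psi>: "\<psi> \<in> K'" "\<phi> n \<in> N \<psi>" using K'(3) \<phi>(1)[of n] by blast
  have "u n \<in> C" by (simp add: C_def)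
  then have "cmod (dual_apply (\<phi> n) (u n) - dual_apply \<psi> (u n)) < d / 2"
    using \<psi>(2) by (simp add: N_def)
  then show False
    using n[OF \<psi>(1)] \<phi>(2)[of n] norm_triangle_sub[of "dual_apply (\<phi> n) (u n)" "dual_apply \<psi> (u n)"]
    by simp
qed

text \<open>Uniform continuity of a continuous function near a compact set, by the usual covering argument.\<close>

lemma continuous_near_compact:
  fixes f :: "'f::complex_lcs dual \<Rightarrow> complex"
  assumes f: "continuous_on UNIV f" and K: "compact K" and e: "0 < e"
  shows "\<exists>C d. compact C \<and> 0 < d \<and> (\<forall>\<phi>\<in>K. \<forall>\<psi>.
    (\<forall>x\<in>C. cmod (dual_apply \<psi> x - dual_apply \<phi> x) < d) \<longrightarrow> cmod (f \<psi> - f \<phi>) < e)"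
proof -
  define N where "N = (\<lambda>\<phi> C d. {\<psi>::'f dual. \<forall>x\<in>C. cmod (dual_apply \<psi> x - dual_apply \<phi> x) < d})"
  have "\<forall>\<phi>. \<exists>C d. compact C \<and> 0 < d \<and> (\<forall>\<psi>\<in>N \<phi> C d. cmod (f \<psi> - f \<phi>) < e / 2)"
  proof
    fix \<phi>
    have "open (f -` ball (f \<phi>) (e / 2))" by (rule open_vimage[OF open_ball f])
    then obtain C d where Cd: "compact C" "0 < d" "N \<phi> C d \<subseteq> f -` ball (f \<phi>) (e / 2)"
    proof (rule dual.open_repE[where f = \<phi>])
      show "\<phi> \<in> f -` ball (f \<phi>) (e / 2)" using e by simp
    qed (auto simp only: N_def intro: that)
    have "cmod (f \<psi> - f \<phi>) < e / 2" if "\<psi> \<in> N \<phi> C d" for \<psi>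
      using subsetD[OF Cd(3) that] by (simp add: dist_norm norm_minus_commute)
    with Cd show "\<exists>C d. compact C \<and> 0 < d \<and> (\<forall>\<psi>\<in>N \<phi> C d. cmod (f \<psi> - f \<phi>) < e / 2)" by blast
  qed
  from choice[OF this] obtain C
    where "\<forall>\<phi>. \<exists>d. compact (C \<phi>) \<and> 0 < d \<and> (\<forall>\<psi>\<in>N \<phi> (C \<phi>) d. cmod (f \<psi> - f \<phi>) < e / 2)" ..
  from choice[OF this] obtain d where Cd: "\<And>\<phi>. compact (C \<phi>)" "\<And>\<phi>. 0 < d \<phi>"
    "\<And>\<phi> \<psi>. \<psi> \<in> N \<phi> (C \<phi>) (d \<phi>) \<Longrightarrow> cmod (f \<psi> - f \<phi>) < e / 2"
    by blast
  have N_open: "open (N \<phi> (C \<phi>) (d \<phi> / 2))" for \<phi>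
    unfolding N_def using Cd(2)[of \<phi>] by (intro dual.open_basic[OF Cd(1)]) simp
  have "\<phi> \<in> N \<phi> (C \<phi>) (d \<phi> / 2)" for \<phi> using Cd(2)[of \<phi>] by (simp add: N_def)
  then have cover: "K \<subseteq> (\<Union>\<phi>\<in>K. N \<phi> (C \<phi>) (d \<phi> / 2))" by blast
  obtain K' where K': "K' \<subseteq> K" "finite K'" "K \<subseteq> (\<Union>\<phi>\<in>K'. N \<phi> (C \<phi>) (d \<phi> / 2))"
    using compactE_image[OF K _ cover] N_open by metis
  define \<delta> where "\<delta> = Min (insert 1 ((\<lambda>\<phi>. d \<phi> / 2) ` K'))"
  show ?thesis
  proof (intro exI[of _ "\<Union>\<phi>\<in>K'. C \<phi>"] exI[of _ \<delta>] conjI ballI allI impI)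
    show "compact (\<Union>\<phi>\<in>K'. C \<phi>)" using K'(2) Cd(1) by (intro compact_UN) auto
    show "0 < \<delta>" unfolding \<delta>_def using K'(2) Cd(2) by (subst Min_gr_iff) auto
    fix \<phi> \<psi> assume \<phi>: "\<phi> \<in> K"
      and near: "\<forall>x\<in>\<Union>\<phi>\<in>K'. C \<phi>. cmod (dual_apply \<psi> x - dual_apply \<phi> x) < \<delta>"
    obtain \<kappa> where \<kappa>: "\<kappa> \<in> K'" "\<phi> \<in> N \<kappa> (C \<kappa>) (d \<kappa> / 2)" using K'(3) \<phi> by blast
    have \<delta>: "\<delta> \<le> d \<kappa> / 2" unfolding \<delta>_def using K'(2) \<kappa>(1) by (intro Min_le) auto
    have "cmod (dual_apply \<psi> x - dual_apply \<kappa> x) < d \<kappa>" if "x \<in> C \<kappa>" for x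
    proof -
      have "cmod (dual_apply \<psi> x - dual_apply \<phi> x) < \<delta>" using near \<kappa>(1) that by blast
      moreover have "cmod (dual_apply \<phi> x - dual_apply \<kappa> x) < d \<kappa> / 2" using \<kappa>(2) that by (simp add: N_def)
      ultimately have "cmod (dual_apply \<psi> x - dual_apply \<kappa> x) < \<delta> + d \<kappa> / 2"
        by (rule norm_diff_triangle_less)
      then show ?thesis using \<delta> by simp
    qed
    then have 1: "cmod (f \<psi> - f \<kappa>) < e / 2" by (intro Cd(3)) (simp add: N_def)
    have 2: "cmod (f \<phi> - f \<kappa>) < e / 2"
    proof (rule Cd(3))
      have "cmod (dual_apply \<phi> x - dual_apply \<kappa> x) < d \<kappa>" if "x \<in> C \<kappa>" for x
      proof -
        have "cmod (dual_apply \<phi> x - dual_apply \<kappa> x) < d \<kappa> / 2"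
          using \<kappa>(2) that by (simp add: N_def)
        then show ?thesis using Cd(2)[of \<kappa>] by simp
      qed
      then show "\<phi> \<in> N \<kappa> (C \<kappa>) (d \<kappa>)" by (simp add: N_def)
    qed
    show "cmod (f \<psi> - f \<phi>) < e"
      using norm_triangle_ineq4[of "f \<psi> - f \<kappa>" "f \<phi> - f \<kappa>"] 1 2 by simp
  qed
qed

text \<open>A dual basis of \<open>span B\<close> modulo the vectors on which all functionals vanish.  It is built by induction
  on \<open>B\<close> as in the Gram-Schmidt process: the part \<open>r\<close> of a new vector \<open>b\<close> that is not yet reproduced is
  either annihilated by the dual or paired with a functional that equals \<open>1\<close> at \<open>b\<close> and vanishes
  on \<open>B\<close>.\<close>

lemma dual_finite_rank_expansion:
  fixes B :: "'f::complex_lcs set"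
  assumes "finite B"
  shows "\<exists>ps :: ('f \<times> 'f dual) list. \<forall>\<phi>. \<forall>b\<in>B.
    dual_apply \<phi> b = (\<Sum>(y, \<psi>)\<leftarrow>ps. dual_apply \<phi> y * dual_apply \<psi> b)"
  using assms
proof (induction B)
  case empty
  show ?case by simp
next
  case (insert b B)
  then obtain ps :: "('f \<times> 'f dual) list" where
    ps: "\<And>\<phi> b. b \<in> B \<Longrightarrow> dual_apply \<phi> b = (\<Sum>(y, \<psi>)\<leftarrow>ps. dual_apply \<phi> y * dual_apply \<psi> b)" by blast
  define r where "r = b - (\<Sum>(y, \<psi>)\<leftarrow>ps. dual_apply \<psi> b *\<^sub>C y)"
  have "dual_apply \<phi> (\<Sum>(y, \<psi>)\<leftarrow>qs. dual_apply \<psi> b *\<^sub>C y) =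
      (\<Sum>(y, \<psi>)\<leftarrow>qs. dual_apply \<phi> y * dual_apply \<psi> b)" for \<phi> and qs :: "('f \<times> 'f dual) list"
    by (induction qs) (auto simp: dual_zero dual_linear)
  then have r: "dual_apply \<phi> r = dual_apply \<phi> b - (\<Sum>(y, \<psi>)\<leftarrow>ps. dual_apply \<phi> y * dual_apply \<psi> b)" for \<phi>
    by (simp add: r_def dual_diff)
  show ?case
  proof (cases "\<forall>\<phi>. dual_apply \<phi> r = 0")
    case True
    then have "dual_apply \<phi> b = (\<Sum>(y, \<psi>)\<leftarrow>ps. dual_apply \<phi> y * dual_apply \<psi> b)" for \<phi>
      using r[of \<phi>] by simp
    with ps show ?thesis by (intro exI[of _ ps]) blast
  next
    case False
    then obtain \<kappa>0 where \<kappa>0: "dual_apply \<kappa>0 r \<noteq> 0" by blast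
    define \<kappa> where "\<kappa> = inverse (dual_apply \<kappa>0 r) *\<^sub>C \<kappa>0"
    have \<kappa>: "dual_apply \<kappa> r = 1" using \<kappa>0 by (simp add: \<kappa>_def dual.rep_scaleC)
    \<comment> \<open>subtracting the expansion of \<open>\<kappa>\<close> makes the functional vanish on \<open>B\<close> and leaves its value at \<open>b\<close> equal to \<open>\<kappa> r\<close>\<close>
    define \<omega> where "\<omega> = \<kappa> - (\<Sum>(y, \<psi>)\<leftarrow>ps. dual_apply \<kappa> y *\<^sub>C \<psi>)"
    have "dual_apply (\<Sum>(y, \<psi>)\<leftarrow>qs. dual_apply \<kappa> y *\<^sub>C \<psi>) x =
      (\<Sum>(y, \<psi>)\<leftarrow>qs. dual_apply \<kappa> y * dual_apply \<psi> x)" for x and qs :: "('f \<times> 'f dual) list"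
      by (induction qs) (auto simp: dual.rep_zero dual.rep_add dual.rep_scaleC)
    then have \<omega>: "dual_apply \<omega> x = dual_apply \<kappa> x - (\<Sum>(y, \<psi>)\<leftarrow>ps. dual_apply \<kappa> y * dual_apply \<psi> x)" for x
      by (simp add: \<omega>_def dual.rep_diff)
    have \<omega>_b: "dual_apply \<omega> b = 1" using \<omega>[of b] r[of \<kappa>] \<kappa> by simp
    have \<omega>_B: "dual_apply \<omega> x = 0" if "x \<in> B" for x
      unfolding \<omega>[of x] ps[OF that, of \<kappa>] by (rule diff_self)
    have "dual_apply \<phi> x = (\<Sum>(y, \<psi>)\<leftarrow>(r, \<omega>) # ps. dual_apply \<phi> y * dual_apply \<psi> x)"
      if "x \<in> insert b B" for \<phi> x
    proof (cases "x = b")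
      case True
      then show ?thesis using r[of \<phi>] \<omega>_b by simp
    next
      case False
      then have "x \<in> B" using that by simp
      from \<omega>_B[OF this] ps[OF this, of \<phi>] show ?thesis by simp
    qed
    then show ?thesis by blast
  qed
qed

text \<open>The transpose of \<open>T\<close> is \<open>\<phi> \<mapsto> (\<Sum>j. \<phi> y\<^sub>j *\<^sub>C (\<psi>\<^sub>j \<circ> T))\<close>, where \<open>y\<^sub>j\<close> and \<open>\<psi>\<^sub>j\<close> expand the functionals
  on \<open>B\<close>; the functionals \<open>\<psi>\<^sub>j \<circ> T\<close> are continuous because \<open>T\<close> is.\<close>

lemma finite_rank_transpose:
  fixes T :: "'f::complex_lcs \<Rightarrow> 'f"
  assumes T: "clinear T" "continuous_on UNIV T"
    and B: "finite B" "range T \<subseteq> complex_vector.span B"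
  shows "\<exists>ps :: ('f \<times> 'f dual) list. \<forall>\<phi> x.
    dual_apply \<phi> (T x) = dual_apply (\<Sum>(y, \<psi>)\<leftarrow>ps. dual_apply \<phi> y *\<^sub>C \<psi>) x"
proof -
  obtain ps :: "('f \<times> 'f dual) list" where
    ps: "\<And>\<phi> b. b \<in> B \<Longrightarrow> dual_apply \<phi> b = (\<Sum>(y, \<psi>)\<leftarrow>ps. dual_apply \<phi> y * dual_apply \<psi> b)"
    using dual_finite_rank_expansion[OF B(1)] by blast
  have span: "dual_apply \<phi> x = (\<Sum>(y, \<psi>)\<leftarrow>ps. dual_apply \<phi> y * dual_apply \<psi> x)"
    if "x \<in> complex_vector.span B" for \<phi> x
    using that
  proof (induction x rule: complex_vector.span_induct_alt)
    case base
    show ?case by (simp add: dual_zero case_prod_unfold)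
  next
    case (step c b x)
    then show ?case
      by (simp add: dual_linear ps[OF step(1), of \<phi>] case_prod_unfold distrib_left
          sum_list_addf sum_list_const_mult[symmetric] mult.left_commute)
  qed
  define t where "t = (\<lambda>\<psi>. Abs_dual (\<lambda>x. dual_apply \<psi> (T x)))"
  have t: "dual_apply (t \<psi>) x = dual_apply \<psi> (T x)" for \<psi> x
  proof -
    have "continuous_on UNIV (\<lambda>x. dual_apply \<psi> (T x))"
      using continuous_on_compose2[OF dual_continuous T(2)] by simp
    moreover have "clinear (\<lambda>x. dual_apply \<psi> (T x))"
      using T(1) by (simp add: clinear_iff dual_linear)
    ultimately show ?thesis by (simp add: t_def Abs_dual_inverse)
  qed
  have "dual_apply (\<Sum>(y, \<psi>)\<leftarrow>map (\<lambda>(y, \<psi>). (y, t \<psi>)) qs. dual_apply \<phi> y *\<^sub>C \<psi>) x =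
      (\<Sum>(y, \<psi>)\<leftarrow>qs. dual_apply \<phi> y * dual_apply \<psi> (T x))" for \<phi> x and qs :: "('f \<times> 'f dual) list"
    by (induction qs) (auto simp: dual.rep_zero dual.rep_add dual.rep_scaleC t)
  then have "dual_apply \<phi> (T x) =
      dual_apply (\<Sum>(y, \<psi>)\<leftarrow>map (\<lambda>(y, \<psi>). (y, t \<psi>)) ps. dual_apply \<phi> y *\<^sub>C \<psi>) x" for \<phi> x
    using span[OF subsetD[OF B(2) rangeI]] by metis
  then show ?thesis by blast
qed

section \<open>Density of the exponentials\<close>

lift_definition exp_entire :: "'f::complex_lcs \<Rightarrow> 'f dual entire" is "\<lambda>x \<phi>. exp (dual_apply \<phi> x)"
  by (auto simp: dual.rep_add dual.rep_scaleC intro!: holomorphic_intros continuous_intros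
      continuous_on_evaluation)

text \<open>The derivative of \<open>t \<mapsto> exp_entire (x + t *\<^sub>C y)\<close> at \<open>0\<close>.\<close>

lift_definition monomial_exp_entire :: "'f::complex_lcs \<Rightarrow> 'f \<Rightarrow> 'f dual entire"
  is "\<lambda>y x \<phi>. dual_apply \<phi> y * exp (dual_apply \<phi> x)"
  by (auto simp: dual.rep_add dual.rep_scaleC intro!: holomorphic_intros continuous_intros
      continuous_on_evaluation)

abbreviation exp_span :: "'f::complex_lcs set \<Rightarrow> 'f dual entire set"
  where "exp_span W \<equiv> complex_vector.span (exp_entire ` W)"

lemma entire_zero_fun: "entire_apply 0 = (\<lambda>_. 0)"
  by (simp add: fun_eq_iff entire.rep_zero)

lemma function_subspace_span: "function_subspace (entire_apply ` complex_vector.span S)"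
  unfolding function_subspace_def
proof (intro conjI ballI allI)
  show "(\<lambda>_. 0) \<in> entire_apply ` complex_vector.span S"
    by (rule image_eqI[OF _ complex_vector.span_zero]) (simp add: fun_eq_iff entire.rep_zero)
next
  fix f g assume "f \<in> entire_apply ` complex_vector.span S" "g \<in> entire_apply ` complex_vector.span S"
  then obtain u v where "f = entire_apply u" "u \<in> complex_vector.span S"
    "g = entire_apply v" "v \<in> complex_vector.span S" by blast
  then show "(\<lambda>x. f x + g x) \<in> entire_apply ` complex_vector.span S"
    by (intro image_eqI[of _ _ "u + v"])
      (simp_all add: fun_eq_iff entire.rep_add complex_vector.span_add)
next
  fix c f assume "f \<in> entire_apply ` complex_vector.span S"
  then obtain u where "f = entire_apply u" "u \<in> complex_vector.span S" by blast
  then show "(\<lambda>x. c * f x) \<in> entire_apply ` complex_vector.span S"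
    by (intro image_eqI[of _ _ "c *\<^sub>C u"])
      (simp_all add: fun_eq_iff entire.rep_scaleC complex_vector.span_scale)
qed

lemma span_approximableI:
  assumes A: "function_subspace A"
    and gen: "\<And>s. s \<in> S \<Longrightarrow> entire_apply s \<in> uniformly_approximable \<K> A"
    and v: "v \<in> complex_vector.span S"
  shows "entire_apply v \<in> uniformly_approximable \<K> A"
proof -
  note sub = function_subspace_uniformly_approximable[OF A, of \<K>]
  from v show ?thesis
  proof (induction v rule: complex_vector.span_induct_alt)
    case base
    show ?case unfolding entire_zero_fun by (rule function_subspace_zero[OF sub])
  next
    case (step c s v)
    have "entire_apply (c *\<^sub>C s + v) = (\<lambda>x. c * entire_apply s x + entire_apply v x)"
      by (simp add: fun_eq_iff entire.rep_add entire.rep_scaleC)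
    then show ?case
      using function_subspace_add[OF sub function_subspace_scale[OF sub gen[OF step(1)]] step(2)]
      by simp
  qed
qed

lemma exp_line_bounds:
  fixes \<phi> :: "'f::complex_lcs dual"
  assumes "cmod (dual_apply \<phi> x) \<le> a" "cmod (dual_apply \<phi> y) \<le> b" "cmod z \<le> R"
  shows "cmod (exp (dual_apply \<phi> (x + z *\<^sub>C y))) \<le> exp (a + R * b)"
proof -
  have "cmod (z * dual_apply \<phi> y) \<le> R * b"
    unfolding norm_mult using assms order_trans[OF norm_ge_zero assms(3)] by (intro mult_mono) auto
  then have "cmod (dual_apply \<phi> (x + z *\<^sub>C y)) \<le> a + R * b"
    unfolding dual_linear using assms(1) norm_triangle_le add_mono by blast
  then show ?thesis
    by (simp add: norm_exp complex_Re_le_cmod order_trans[OF complex_Re_le_cmod])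
qed

lemma exp_line_holomorphic: "(\<lambda>z. exp (dual_apply \<phi> (x + z *\<^sub>C y))) holomorphic_on UNIV"
  by (simp add: dual_linear) (intro holomorphic_intros)

lemma exp_line_taylor_coeff:
  "taylor_coeff (\<lambda>z. exp (dual_apply \<phi> (x + z *\<^sub>C y))) 0 = exp (dual_apply \<phi> x)"
  "taylor_coeff (\<lambda>z. exp (dual_apply \<phi> (x + z *\<^sub>C y))) (Suc 0) = dual_apply \<phi> y * exp (dual_apply \<phi> x)"
proof -
  have "((\<lambda>z. exp (dual_apply \<phi> (x + z *\<^sub>C y))) has_field_derivative
      dual_apply \<phi> y * exp (dual_apply \<phi> x)) (at 0)"
    unfolding dual_linear by (auto intro!: derivative_eq_intros)
  then show "taylor_coeff (\<lambda>z. exp (dual_apply \<phi> (x + z *\<^sub>C y))) (Suc 0) =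
      dual_apply \<phi> y * exp (dual_apply \<phi> x)"
    by (simp add: taylor_coeff_def DERIV_imp_deriv)
qed (simp add: taylor_coeff_def dual_linear)

text \<open>The curve \<open>t \<mapsto> exp_entire (x + t *\<^sub>C y)\<close> is entire, so it cannot leave the closed span of its values at small \<open>t\<close>.\<close>

lemma exp_line_approximable:
  fixes x y :: "'f::complex_lcs"
  assumes r: "0 < r" and W: "\<And>t. cmod t < r \<Longrightarrow> x + t *\<^sub>C y \<in> W"
    and bounded: "\<And>K. K \<in> \<K> \<Longrightarrow> \<exists>M. \<forall>\<phi>\<in>K. cmod (dual_apply \<phi> x) \<le> M"
      "\<And>K. K \<in> \<K> \<Longrightarrow> \<exists>M. \<forall>\<phi>\<in>K. cmod (dual_apply \<phi> y) \<le> M"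
  shows "entire_apply (exp_entire (x + s *\<^sub>C y)) \<in> uniformly_approximable \<K> (entire_apply ` exp_span W)"
    and "entire_apply (monomial_exp_entire y x) \<in> uniformly_approximable \<K> (entire_apply ` exp_span W)"
proof -
  define G where "G = (\<lambda>z \<phi>. exp (dual_apply \<phi> (x + z *\<^sub>C y)))"
  note A = function_subspace_span[of "exp_entire ` W"]
  have hol: "(\<lambda>z. G z \<phi>) holomorphic_on UNIV" for \<phi>
    unfolding G_def by (rule exp_line_holomorphic)
  have bound: "\<exists>M. \<forall>\<phi>\<in>K. \<forall>z. cmod z \<le> R \<longrightarrow> cmod (G z \<phi>) \<le> M" if K: "K \<in> \<K>" for K R
  proof -
    obtain a where a: "\<And>\<phi>. \<phi> \<in> K \<Longrightarrow> cmod (dual_apply \<phi> x) \<le> a" using bounded(1)[OF K] by blast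
    obtain b where b: "\<And>\<phi>. \<phi> \<in> K \<Longrightarrow> cmod (dual_apply \<phi> y) \<le> b" using bounded(2)[OF K] by blast
    show ?thesis
      unfolding G_def using a b by (intro exI[of _ "exp (a + R * b)"] ballI allI impI exp_line_bounds) auto
  qed
  have mem: "G t \<in> uniformly_approximable \<K> (entire_apply ` exp_span W)" if "cmod t < r" for t
  proof (rule subsetD[OF uniformly_approximable_superset])
    have "G t = entire_apply (exp_entire (x + t *\<^sub>C y))"
      by (simp add: G_def fun_eq_iff exp_entire.rep_eq)
    then show "G t \<in> entire_apply ` exp_span W"
      using W[OF that] by (auto intro!: imageI complex_vector.span_base)
  qed
  have "(\<lambda>\<phi>. G s \<phi>) \<in> uniformly_approximable \<K> (entire_apply ` exp_span W)"
    by (rule entire_curve_approximable[where u = "\<lambda>_. s", OF A hol bound r mem])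
      (auto intro: function_subspace_scale[OF function_subspace_uniformly_approximable[OF A]])
  moreover have "entire_apply (exp_entire (x + s *\<^sub>C y)) = (\<lambda>\<phi>. G s \<phi>)"
    by (simp add: G_def fun_eq_iff exp_entire.rep_eq)
  ultimately show "entire_apply (exp_entire (x + s *\<^sub>C y)) \<in>
      uniformly_approximable \<K> (entire_apply ` exp_span W)" by simp
  have "(\<lambda>\<phi>. taylor_coeff (\<lambda>z. G z \<phi>) (Suc 0)) \<in> uniformly_approximable \<K> (entire_apply ` exp_span W)"
    by (rule taylor_coeff_approximable[OF A hol bound r mem])
  moreover have "(\<lambda>\<phi>. taylor_coeff (\<lambda>z. G z \<phi>) (Suc 0)) = entire_apply (monomial_exp_entire y x)"
    by (simp add: G_def fun_eq_iff exp_line_taylor_coeff monomial_exp_entire.rep_eq)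
  ultimately show "entire_apply (monomial_exp_entire y x) \<in>
      uniformly_approximable \<K> (entire_apply ` exp_span W)" by simp
qed

text \<open>Multiplication by the coordinate \<open>\<phi> \<mapsto> \<phi> y\<close> sends \<open>exp_entire x\<close> to a derivative along the direction \<open>y\<close>,
  which is a limit of combinations of exponentials.\<close>

lemma evaluation_mult_approximable:
  fixes y :: "'f::complex_lcs"
  assumes h: "h \<in> uniformly_approximable (Collect compact) (entire_apply ` exp_span UNIV)"
  shows "(\<lambda>\<phi>. dual_apply \<phi> y * h \<phi>) \<in> uniformly_approximable (Collect compact) (entire_apply ` exp_span UNIV)"
proof (rule uniformly_approximable_trans)
  let ?M = "uniformly_approximable (Collect compact) (entire_apply ` exp_span (UNIV :: 'f set))"
  note sub = function_subspace_uniformly_approximable[OF function_subspace_span, of "Collect compact"]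
  fix K :: "'f dual set" and e :: real assume K: "K \<in> Collect compact" and e: "0 < e"
  obtain b where b: "\<And>\<phi>. \<phi> \<in> K \<Longrightarrow> cmod (dual_apply \<phi> y) \<le> b"
    using compact_dual_bounded[of K] K by blast
  define B where "B = max 1 b"
  have B: "0 < B" "\<And>\<phi>. \<phi> \<in> K \<Longrightarrow> cmod (dual_apply \<phi> y) \<le> B"
    using b by (auto simp: B_def le_max_iff_disj)
  have eB: "0 < e / B" using e B(1) by simp
  obtain g where g: "g \<in> entire_apply ` exp_span UNIV" "\<And>\<phi>. \<phi> \<in> K \<Longrightarrow> cmod (h \<phi> - g \<phi>) < e / B"
    by (rule uniformly_approximableD[OF h K eB]) blast
  obtain v where v: "g = entire_apply v" "v \<in> exp_span UNIV" using g(1) by blast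
  have "(\<lambda>\<phi>. dual_apply \<phi> y * entire_apply v \<phi>) \<in> ?M"
    using v(2)
  proof (induction v rule: complex_vector.span_induct_alt)
    case base
    show ?case
      unfolding entire.rep_zero mult_zero_right by (rule function_subspace_zero[OF sub])
  next
    case (step c s v)
    then obtain x where x: "s = exp_entire x" by blast
    have "entire_apply (monomial_exp_entire y x) \<in> ?M"
      by (rule exp_line_approximable(2)[of 1]) (auto intro: compact_dual_bounded)
    from function_subspace_add[OF sub function_subspace_scale[OF sub this, of c] step(2)]
    show ?case
      by (simp add: x entire.rep_add entire.rep_scaleC exp_entire.rep_eq monomial_exp_entire.rep_eq
          distrib_left mult.left_commute)
  qed
  moreover have "cmod (dual_apply \<phi> y * h \<phi> - dual_apply \<phi> y * g \<phi>) < e" if "\<phi> \<in> K" for \<phi>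
  proof -
    have "cmod (dual_apply \<phi> y * h \<phi> - dual_apply \<phi> y * g \<phi>) = cmod (dual_apply \<phi> y) * cmod (h \<phi> - g \<phi>)"
      by (metis norm_mult right_diff_distrib)
    also have "\<dots> \<le> B * cmod (h \<phi> - g \<phi>)" using B(2)[OF that] by (intro mult_right_mono) auto
    also have "\<dots> < B * (e / B)" using g(2)[OF that] B(1) by (intro mult_strict_left_mono) auto
    finally show ?thesis using B(1) by simp
  qed
  ultimately show "\<exists>g\<in>?M. \<forall>\<phi>\<in>K. cmod (dual_apply \<phi> y * h \<phi> - g \<phi>) < e"
    unfolding v(1) by (intro bexI[where x = "\<lambda>\<phi>. dual_apply \<phi> y * entire_apply v \<phi>"] ballI)
qed

lemma continuous_on_finite_rank:
  fixes ps :: "('f::complex_lcs \<times> 'f dual) list"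
  shows "continuous_on S (\<lambda>\<phi>. \<Sum>(y, \<psi>)\<leftarrow>ps. dual_apply \<phi> y *\<^sub>C \<psi>)"
  by (induction ps)
    (auto intro!: continuous_intros continuous_on_scaleC continuous_on_evaluation)

lemma translate_apply: "entire_apply (translate a f) x = entire_apply f (x - a)"
  by (simp add: translate.rep_eq)

lemma entire_continuous: "continuous_on UNIV (entire_apply f)"
  by (rule entire.continuous_rep)

lemma entire_line_holomorphic: "(\<lambda>z. entire_apply f (a + z *\<^sub>C b)) holomorphic_on UNIV"
  using entire_apply[of f] by blast

text \<open>Induction on the number of coordinates.  Freezing the last coordinate \<open>\<phi> y\<close> at a value \<open>t\<close> leaves a
  function of the same form with fewer coordinates and a translate of \<open>f\<close>, so it is approximable for every \<open>t\<close>.\<close>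

lemma finite_rank_composition_approximable:
  fixes f :: "'f::complex_lcs dual entire" and ps :: "('f \<times> 'f dual) list"
  shows "(\<lambda>\<phi>. entire_apply f (\<Sum>(y, \<psi>)\<leftarrow>ps. dual_apply \<phi> y *\<^sub>C \<psi>)) \<in>
    uniformly_approximable (Collect compact) (entire_apply ` exp_span UNIV)"
proof (induction ps arbitrary: f)
  case Nil
  have one: "entire_apply (exp_entire 0) \<in> uniformly_approximable (Collect compact) (entire_apply ` exp_span (UNIV :: 'f set))"
    by (rule subsetD[OF uniformly_approximable_superset])
      (auto intro!: imageI complex_vector.span_base)
  have "(\<lambda>\<phi>. entire_apply f 0 * entire_apply (exp_entire (0 :: 'f)) \<phi>) \<in>
      uniformly_approximable (Collect compact) (entire_apply ` exp_span UNIV)"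
    by (rule function_subspace_scale[OF function_subspace_uniformly_approximable[OF function_subspace_span] one])
  then show ?case by (simp add: exp_entire.rep_eq dual_zero)
next
  case (Cons p ps)
  obtain y \<psi> where p: "p = (y, \<psi>)" by fastforce
  define S where "S = (\<lambda>\<phi> :: 'f dual. \<Sum>(y, \<psi>)\<leftarrow>ps. dual_apply \<phi> y *\<^sub>C \<psi>)"
  define G where "G = (\<lambda>z \<phi>. entire_apply f (S \<phi> + z *\<^sub>C \<psi>))"
  have "(\<lambda>\<phi>. G (dual_apply \<phi> y) \<phi>) \<in> uniformly_approximable (Collect compact) (entire_apply ` exp_span UNIV)"
  proof (rule entire_curve_approximable[where G = G and u = "\<lambda>\<phi>. dual_apply \<phi> y" and r = 1])
    show "(\<lambda>z. G z \<phi>) holomorphic_on UNIV" for \<phi>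
      unfolding G_def by (rule entire_line_holomorphic)
    show "\<exists>M. \<forall>\<phi>\<in>K. \<forall>z. cmod z \<le> R \<longrightarrow> cmod (G z \<phi>) \<le> M" if "K \<in> Collect compact" for K R
    proof -
      have S: "continuous_on T (\<lambda>p. S (fst p))" for T :: "('f dual \<times> complex) set"
        unfolding S_def
        by (rule continuous_on_compose2[OF continuous_on_finite_rank[of UNIV]])
          (auto intro!: continuous_intros)
      have "continuous_on (K \<times> cball 0 R) (\<lambda>p. entire_apply f (S (fst p) + snd p *\<^sub>C \<psi>))"
        by (rule continuous_on_compose2[OF entire_continuous])
          (auto intro!: continuous_on_scaleC continuous_intros S)
      then have "bounded ((\<lambda>p. entire_apply f (S (fst p) + snd p *\<^sub>C \<psi>)) ` (K \<times> cball 0 R))"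
        using that by (intro compact_imp_bounded compact_continuous_image compact_Times) auto
      then obtain M where M: "\<And>p. p \<in> K \<times> cball 0 R \<Longrightarrow>
          cmod (entire_apply f (S (fst p) + snd p *\<^sub>C \<psi>)) \<le> M"
        unfolding bounded_iff by blast
      have "cmod (G z \<phi>) \<le> M" if "\<phi> \<in> K" "cmod z \<le> R" for \<phi> z
        using M[of "(\<phi>, z)"] that by (simp add: G_def)
      then show ?thesis by blast
    qed
    show "G t \<in> uniformly_approximable (Collect compact) (entire_apply ` exp_span UNIV)" for t
    proof -
      have "G t = (\<lambda>\<phi>. entire_apply (translate (- (t *\<^sub>C \<psi>)) f) (S \<phi>))"
        by (simp add: G_def translate_apply)
      then show ?thesis using Cons[of "translate (- (t *\<^sub>C \<psi>)) f"] by (simp add: S_def)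
    qed
  qed (auto intro: function_subspace_span evaluation_mult_approximable compact_dual_bounded)
  then show ?case by (simp add: G_def S_def p add.commute)
qed

text \<open>For \<open>\<phi>\<close> in a compact set \<open>K\<close> of functionals, \<open>\<phi> \<circ> T\<close> is close to \<open>\<phi>\<close> in the topology of the dual
  if \<open>T\<close> is close to the identity on a suitable compact set \<open>C\<close>, because \<open>K\<close> is equicontinuous.\<close>

theorem exponentials_dense:
  fixes f :: "'f::{complex_lcs,metric_space} dual entire"
  assumes AP: "approximation_property TYPE('f)"
  shows "entire_apply f \<in> uniformly_approximable (Collect compact) (entire_apply ` exp_span UNIV)"
proof (rule uniformly_approximable_trans)
  fix K :: "'f dual set" and e :: real assume "K \<in> Collect compact" and e: "0 < e"
  then have K: "compact K" by simp
  obtain C d where C: "compact C" "0 < d" and near: "\<And>\<phi> \<psi>. \<phi> \<in> K \<Longrightarrow>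
      (\<And>x. x \<in> C \<Longrightarrow> cmod (dual_apply \<psi> x - dual_apply \<phi> x) < d) \<Longrightarrow>
      cmod (entire_apply f \<psi> - entire_apply f \<phi>) < e"
    using continuous_near_compact[OF entire_continuous[of f] K e] by metis
  obtain \<eta> where \<eta>: "0 < \<eta>" "\<And>x \<phi>. x \<in> ball 0 \<eta> \<Longrightarrow> \<phi> \<in> K \<Longrightarrow> cmod (dual_apply \<phi> x) < d"
    using compact_dual_equicontinuous[OF K C(2)] by blast
  obtain T :: "'f \<Rightarrow> 'f" and B where T: "clinear T" "continuous_on UNIV T" "finite B"
    "range T \<subseteq> complex_vector.span B" "\<And>x. x \<in> C \<Longrightarrow> T x - x \<in> ball 0 \<eta>"
    using AP[unfolded approximation_property_def, rule_format, OF C(1) open_ball, of 0 \<eta>] \<eta>(1) by auto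
  obtain ps :: "('f \<times> 'f dual) list" where
    ps: "\<And>\<phi> x. dual_apply \<phi> (T x) = dual_apply (\<Sum>(y, \<psi>)\<leftarrow>ps. dual_apply \<phi> y *\<^sub>C \<psi>) x"
    using finite_rank_transpose[OF T(1-4)] by blast
  have "cmod (entire_apply f \<phi> - entire_apply f (\<Sum>(y, \<psi>)\<leftarrow>ps. dual_apply \<phi> y *\<^sub>C \<psi>)) < e" if "\<phi> \<in> K" for \<phi>
  proof -
    have "cmod (entire_apply f (\<Sum>(y, \<psi>)\<leftarrow>ps. dual_apply \<phi> y *\<^sub>C \<psi>) - entire_apply f \<phi>) < e"
      using \<eta>(2)[OF T(5) that] by (intro near that) (simp add: ps[symmetric] dual_diff)
    then show ?thesis by (simp add: norm_minus_commute)
  qed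
  then show "\<exists>g\<in>uniformly_approximable (Collect compact) (entire_apply ` exp_span UNIV).
      \<forall>\<phi>\<in>K. cmod (entire_apply f \<phi> - g \<phi>) < e"
    by (intro bexI[OF _ finite_rank_composition_approximable[of f ps]]) auto
qed

section \<open>An exhaustion of the dual by open sets\<close>

lemma dense_eventually:
  assumes "closure D = UNIV" "eventually P (nhds x)"
  shows "\<exists>d\<in>D. P d"
proof -
  obtain S where S: "open S" "x \<in> S" "\<And>y. y \<in> S \<Longrightarrow> P y"
    using assms(2) unfolding eventually_nhds by blast
  have "S \<inter> D \<noteq> {}" using open_Int_closure_eq_empty[OF S(1), of D] assms(1) S(2) by auto
  then show ?thesis using S(3) by blast
qed

text \<open>For a compact \<open>C\<close> these sets are open and exhaust the dual.\<close>

definition dual_ball :: "'f::complex_lcs set \<Rightarrow> real \<Rightarrow> 'f dual set"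
  where "dual_ball C r = {\<phi>. \<forall>x\<in>C. cmod (dual_apply \<phi> x) < r}"

text \<open>The exponents \<open>x\<close> for which \<open>exp_entire x\<close> can be approximated uniformly on the sets \<open>dual_ball C r\<close>, not only on compact ones.\<close>

definition bounded_vectors :: "'f::complex_lcs set \<Rightarrow> 'f set"
  where "bounded_vectors C = {x. \<forall>r. \<exists>M. \<forall>\<phi>\<in>dual_ball C r. cmod (dual_apply \<phi> x) \<le> M}"

lemma dual_ball_mono: "r \<le> s \<Longrightarrow> dual_ball C r \<subseteq> dual_ball C s"
  unfolding dual_ball_def using less_le_trans by blast

lemma dual_ball_add:
  assumes "\<phi> \<in> dual_ball C r" "\<psi> \<in> dual_ball C s"
  shows "\<phi> + \<psi> \<in> dual_ball C (r + s)"
proof -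
  have "cmod (dual_apply (\<phi> + \<psi>) x) < r + s" if "x \<in> C" for x
    unfolding dual.rep_add using assms that by (intro norm_add_less) (simp_all add: dual_ball_def)
  then show ?thesis by (simp add: dual_ball_def)
qed

lemma open_dual_ball: "compact C \<Longrightarrow> 0 < r \<Longrightarrow> open (dual_ball C r)"
  using dual.open_basic[of C r 0] by (simp add: dual_ball_def dual.rep_zero)

lemma in_dual_ball:
  assumes "compact C"
  shows "\<exists>n. \<phi> \<in> dual_ball C (real (Suc n))"
proof -
  have "bounded (dual_apply \<phi> ` C)"
    by (intro compact_imp_bounded compact_continuous_image assms
        continuous_on_subset[OF dual_continuous]) auto
  then obtain M where M: "\<And>x. x \<in> C \<Longrightarrow> cmod (dual_apply \<phi> x) \<le> M" by (auto simp: bounded_iff)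
  obtain n where "M < real n" using reals_Archimedean2 by blast
  then have "M < real (Suc n)" by simp
  then have "cmod (dual_apply \<phi> x) < real (Suc n)" if "x \<in> C" for x using M[OF that] by linarith
  then have "\<phi> \<in> dual_ball C (real (Suc n))" unfolding dual_ball_def by blast
  then show ?thesis ..
qed

lemma compact_subset_dual_ball:
  assumes C: "compact C" and K: "compact K"
  shows "\<exists>n. K \<subseteq> dual_ball C (real n)"
proof -
  have cover: "K \<subseteq> (\<Union>n\<in>UNIV. dual_ball C (real (Suc n)))" using in_dual_ball[OF C] by blast
  obtain N where N: "finite N" "K \<subseteq> (\<Union>n\<in>N. dual_ball C (real (Suc n)))"
    using compactE_image[OF K _ cover] open_dual_ball[OF C] by (metis of_nat_0_less_iff zero_less_Suc)
  have "dual_ball C (real (Suc n)) \<subseteq> dual_ball C (real (Suc (Max N)))" if "n \<in> N" for n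
    using Max_ge[OF N(1) that] by (intro dual_ball_mono) simp
  with N(2) show ?thesis by blast
qed

lemma bounded_vectors_add_scale:
  assumes "x \<in> bounded_vectors C" "y \<in> bounded_vectors C"
  shows "x + t *\<^sub>C y \<in> bounded_vectors C"
  unfolding bounded_vectors_def
proof safe
  fix r
  obtain a where a: "\<And>\<phi>. \<phi> \<in> dual_ball C r \<Longrightarrow> cmod (dual_apply \<phi> x) \<le> a"
    using assms(1) unfolding bounded_vectors_def by blast
  obtain b where b: "\<And>\<phi>. \<phi> \<in> dual_ball C r \<Longrightarrow> cmod (dual_apply \<phi> y) \<le> b"
    using assms(2) unfolding bounded_vectors_def by blast
  have "cmod (dual_apply \<phi> (x + t *\<^sub>C y)) \<le> a + cmod t * b" if "\<phi> \<in> dual_ball C r" for \<phi>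
  proof -
    have "cmod (dual_apply \<phi> (x + t *\<^sub>C y)) \<le> cmod (dual_apply \<phi> x) + cmod t * cmod (dual_apply \<phi> y)"
      unfolding dual_linear using norm_triangle_ineq[of "dual_apply \<phi> x" "t * dual_apply \<phi> y"]
      by (simp add: norm_mult)
    also have "\<dots> \<le> a + cmod t * b" using a[OF that] b[OF that] by (intro add_mono mult_left_mono) auto
    finally show ?thesis .
  qed
  then show "\<exists>M. \<forall>\<phi>\<in>dual_ball C r. cmod (dual_apply \<phi> (x + t *\<^sub>C y)) \<le> M" by blast
qed

text \<open>Scale an enumeration of \<open>D\<close> to a null sequence \<open>t\<^sub>n x\<^sub>n\<close> and let \<open>C\<close> be its range together with \<open>0\<close>: on \<open>dual_ball C r\<close>
  the modulus of \<open>\<phi> x\<^sub>n\<close> is at most \<open>r / t\<^sub>n\<close>.\<close>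

lemma countable_subset_bounded_vectors:
  fixes D :: "'f::{complex_lcs,metric_space} set"
  assumes "countable D"
  shows "\<exists>C. compact C \<and> D \<subseteq> bounded_vectors C"
proof (cases "D = {}")
  case True
  then show ?thesis by (intro exI[of _ "{}"]) auto
next
  case False
  define x where "x = from_nat_into D"
  have "\<exists>t::real. 0 < t \<and> dist (complex_of_real t *\<^sub>C x n) 0 < inverse (real (Suc n))" for n
  proof -
    have "((\<lambda>t. complex_of_real t *\<^sub>C x n) \<longlongrightarrow> complex_of_real 0 *\<^sub>C x n) (at_right 0)"
      by (intro tendsto_scaleC tendsto_intros)
    then have "\<forall>\<^sub>F t in at_right 0. dist (complex_of_real t *\<^sub>C x n) 0 < inverse (real (Suc n))"
      by (intro tendstoD) simp_all
    moreover have "\<forall>\<^sub>F t in at_right 0. (0::real) < t" by (rule eventually_at_right_less)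
    ultimately have "\<forall>\<^sub>F t in at_right 0. 0 < t \<and> dist (complex_of_real t *\<^sub>C x n) 0 < inverse (real (Suc n))"
      by eventually_elim simp
    then show ?thesis using eventually_happens'[OF trivial_limit_at_right_real] by blast
  qed
  then obtain t :: "nat \<Rightarrow> real" where t: "\<And>n. 0 < t n"
    "\<And>n. dist (complex_of_real (t n) *\<^sub>C x n) 0 < inverse (real (Suc n))" by metis
  define C where "C = insert 0 (range (\<lambda>n. complex_of_real (t n) *\<^sub>C x n))"
  have "(\<lambda>n. complex_of_real (t n) *\<^sub>C x n) \<longlonglongrightarrow> 0"
  proof (rule tendstoI)
    fix e :: real assume "0 < e"
    show "\<forall>\<^sub>F n in sequentially. dist (complex_of_real (t n) *\<^sub>C x n) 0 < e"
      using order_tendstoD(2)[OF LIMSEQ_inverse_real_of_nat \<open>0 < e\<close>]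
    proof eventually_elim
      case (elim n)
      with t(2)[of n] show ?case by linarith
    qed
  qed
  then have "compact C" unfolding C_def by (rule compact_sequence_insert_limit)
  moreover have "x n \<in> bounded_vectors C" for n
    unfolding bounded_vectors_def
  proof safe
    fix r
    have "cmod (dual_apply \<phi> (x n)) \<le> r / t n" if "\<phi> \<in> dual_ball C r" for \<phi>
    proof -
      have "complex_of_real (t n) *\<^sub>C x n \<in> C" by (simp add: C_def)
      then have "cmod (dual_apply \<phi> (complex_of_real (t n) *\<^sub>C x n)) < r"
        using that by (simp only: dual_ball_def mem_Collect_eq)
      then show ?thesis using t(1)[of n] by (simp add: dual_linear norm_mult field_simps)
    qed
    then show "\<exists>M. \<forall>\<phi>\<in>dual_ball C r. cmod (dual_apply \<phi> (x n)) \<le> M" by blast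
  qed
  moreover have "D = range x" using assms False by (simp add: x_def range_from_nat_into)
  ultimately show ?thesis by blast
qed

text \<open>Move from a point \<open>x\<close> of \<open>U\<close> to \<open>z\<close> along a complex line; all exponents on the line are bounded vectors.\<close>

lemma exp_bounded_vectors_approximable:
  fixes U :: "'f::complex_lcs set"
  assumes U: "open U" "x \<in> U" "x \<in> bounded_vectors C" and z: "z \<in> bounded_vectors C"
  shows "entire_apply (exp_entire z) \<in>
    uniformly_approximable (range (dual_ball C)) (entire_apply ` exp_span (bounded_vectors C \<inter> U))"
proof -
  define y where "y = z + (-1) *\<^sub>C x"
  have y: "y \<in> bounded_vectors C" unfolding y_def using z U(3) by (rule bounded_vectors_add_scale)
  have "((\<lambda>t. x + t *\<^sub>C y) \<longlongrightarrow> x + 0 *\<^sub>C y) (nhds 0)"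
    by (intro tendsto_intros tendsto_scaleC filterlim_ident)
  then have "\<forall>\<^sub>F t in nhds 0. x + t *\<^sub>C y \<in> U"
    using U by (intro topological_tendstoD) simp_all
  then obtain r where r: "0 < r" "\<And>t. cmod t < r \<Longrightarrow> x + t *\<^sub>C y \<in> U"
    by (auto simp: eventually_nhds_metric)
  have "x + 1 *\<^sub>C y = z" by (simp add: y_def complex_vector.scale_minus_left scaleC_one)
  moreover have "entire_apply (exp_entire (x + 1 *\<^sub>C y)) \<in>
    uniformly_approximable (range (dual_ball C)) (entire_apply ` exp_span (bounded_vectors C \<inter> U))"
  proof (rule exp_line_approximable(1)[OF r(1)])
    show "x + t *\<^sub>C y \<in> bounded_vectors C \<inter> U" if "cmod t < r" for t
      using r(2)[OF that] bounded_vectors_add_scale[OF U(3) y] by simp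
  qed (use U(3) y in \<open>auto simp: bounded_vectors_def\<close>)
  ultimately show ?thesis by simp
qed

text \<open>The difference of two exponentials is \<open>exp (\<phi> x) * (exp (\<phi> (g t - x)) - 1)\<close>, which is small
  uniformly for \<open>\<phi>\<close> in a compact set by equicontinuity.\<close>

lemma tendsto_exp_entire:
  fixes g :: "'b \<Rightarrow> 'f::{complex_lcs,metric_space}"
  assumes g: "(g \<longlongrightarrow> x) F"
  shows "((\<lambda>t. exp_entire (g t)) \<longlongrightarrow> exp_entire x) F"
  unfolding entire.tendsto_rep_iff
proof (intro allI impI)
  fix K :: "'f dual set" and e :: real assume K: "compact K" and e: "0 < e"
  obtain M where M: "\<And>\<phi>. \<phi> \<in> K \<Longrightarrow> cmod (dual_apply \<phi> x) \<le> M"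
    using compact_dual_bounded[OF K] by blast
  have "\<forall>\<^sub>F w in nhds (0 :: complex). dist (exp w) (exp 0) < e / exp M"
  proof (rule tendstoD)
    show "(exp \<longlongrightarrow> exp (0 :: complex)) (nhds 0)" by (intro tendsto_exp filterlim_ident)
  qed (use e in simp)
  then obtain d where d: "0 < d" "\<And>w :: complex. cmod w < d \<Longrightarrow> cmod (exp w - 1) < e / exp M"
    by (auto simp: eventually_nhds_metric dist_norm)
  obtain \<eta> where \<eta>: "0 < \<eta>" "\<And>y \<phi>. y \<in> ball 0 \<eta> \<Longrightarrow> \<phi> \<in> K \<Longrightarrow> cmod (dual_apply \<phi> y) < d"
    using compact_dual_equicontinuous[OF K d(1)] by blast
  have "((\<lambda>t. g t - x) \<longlongrightarrow> x - x) F" by (intro tendsto_intros g)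
  then have "\<forall>\<^sub>F t in F. g t - x \<in> ball 0 \<eta>"
  proof (rule topological_tendstoD)
    show "x - x \<in> ball 0 \<eta>" using \<eta>(1) by (simp only: diff_self centre_in_ball)
  qed simp
  then show "\<forall>\<^sub>F t in F. \<forall>\<phi>\<in>K. cmod (entire_apply (exp_entire (g t)) \<phi> - entire_apply (exp_entire x) \<phi>) < e"
  proof eventually_elim
    case (elim t)
    show ?case
    proof
      fix \<phi> assume \<phi>: "\<phi> \<in> K"
      have "dual_apply \<phi> (g t) = dual_apply \<phi> x + dual_apply \<phi> (g t - x)" by (simp add: dual_diff)
      then have "entire_apply (exp_entire (g t)) \<phi> - entire_apply (exp_entire x) \<phi> =
          exp (dual_apply \<phi> x) * (exp (dual_apply \<phi> (g t - x)) - 1)"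
        by (simp add: exp_entire.rep_eq exp_add right_diff_distrib)
      also have "cmod \<dots> = cmod (exp (dual_apply \<phi> x)) * cmod (exp (dual_apply \<phi> (g t - x)) - 1)"
        by (rule norm_mult)
      also have "\<dots> \<le> exp M * cmod (exp (dual_apply \<phi> (g t - x)) - 1)"
        using M[OF \<phi>] by (intro mult_right_mono)
          (auto simp: norm_exp_eq_Re intro: order_trans[OF complex_Re_le_cmod])
      also have "\<dots> < exp M * (e / exp M)"
        using d(2) \<eta>(2)[OF elim \<phi>] by (intro mult_strict_left_mono) auto
      finally show "cmod (entire_apply (exp_entire (g t)) \<phi> - entire_apply (exp_entire x) \<phi>) < e" by simp
    qed
  qed
qed

text \<open>Three approximations: of \<open>f\<close> by exponential sums, of their exponents by vectors of \<open>D\<close>, and of the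
  exponentials of these by exponentials with exponents in \<open>U\<close>.\<close>

theorem exponentials_over_open_set_dense:
  fixes f :: "'f::{complex_lcs,metric_space} dual entire"
  assumes AP: "approximation_property TYPE('f)"
    and C: "compact C" and D: "closure D = UNIV" "D \<subseteq> bounded_vectors C" and U: "open U" "U \<noteq> {}"
  shows "entire_apply f \<in>
    uniformly_approximable (Collect compact) (entire_apply ` exp_span (bounded_vectors C \<inter> U))"
    (is "_ \<in> ?M")
proof -
  obtain u where "u \<in> U" using U(2) by blast
  then have "\<forall>\<^sub>F x in nhds u. x \<in> U" using U(1) by (intro eventually_nhds_in_open)
  from dense_eventually[OF D(1) this] obtain x where x: "x \<in> U" "x \<in> bounded_vectors C"
    using D(2) by blast
  have exp: "entire_apply (exp_entire y) \<in> ?M" for y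
  proof (rule uniformly_approximable_trans)
    fix K :: "'f dual set" and e :: real assume "K \<in> Collect compact" and e: "0 < e"
    then have K: "compact K" by simp
    have "\<forall>\<^sub>F d in nhds y. \<forall>\<phi>\<in>K. cmod (entire_apply (exp_entire d) \<phi> - entire_apply (exp_entire y) \<phi>) < e"
      by (rule entire.tendsto_rep_iff[THEN iffD1, OF tendsto_exp_entire[OF filterlim_ident], rule_format, OF K e])
    from dense_eventually[OF D(1) this] obtain d where d: "d \<in> D"
      "\<forall>\<phi>\<in>K. cmod (entire_apply (exp_entire d) \<phi> - entire_apply (exp_entire y) \<phi>) < e" by blast
    have "entire_apply (exp_entire d) \<in>
        uniformly_approximable (range (dual_ball C)) (entire_apply ` exp_span (bounded_vectors C \<inter> U))"
      using d(1) D(2) by (intro exp_bounded_vectors_approximable[OF U(1) x]) auto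
    then have "entire_apply (exp_entire d) \<in> ?M"
    proof (rule uniformly_approximable_mono[rotated])
      fix K :: "'f dual set" assume "K \<in> Collect compact"
      then show "\<exists>K'\<in>range (dual_ball C). K \<subseteq> K'"
        using compact_subset_dual_ball[OF C, of K] by blast
    qed
    then show "\<exists>g\<in>?M. \<forall>\<phi>\<in>K. cmod (entire_apply (exp_entire y) \<phi> - g \<phi>) < e"
      by (rule bexI[rotated]) (use d(2) in \<open>simp add: norm_minus_commute\<close>)
  qed
  show ?thesis
  proof (rule uniformly_approximable_trans)
    fix K :: "'f dual set" and e :: real assume K: "K \<in> Collect compact" and e: "0 < e"
    obtain v where v: "v \<in> exp_span UNIV" "\<And>\<phi>. \<phi> \<in> K \<Longrightarrow> cmod (entire_apply f \<phi> - entire_apply v \<phi>) < e"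
      using approximable_imageE[OF exponentials_dense[OF AP, of f] K e] by blast
    have "entire_apply v \<in> ?M"
      by (rule span_approximableI[OF function_subspace_span _ v(1)]) (use exp in auto)
    then show "\<exists>g\<in>?M. \<forall>\<phi>\<in>K. cmod (entire_apply f \<phi> - g \<phi>) < e"
      by (rule bexI[rotated]) (use v(2) in blast)
  qed
qed

lemma approximable_meets_open:
  assumes "\<And>f. entire_apply f \<in> uniformly_approximable (Collect compact) (entire_apply ` S)"
    and V: "open V" "V \<noteq> {}"
  shows "\<exists>g\<in>S. g \<in> V"
proof -
  obtain f where f: "f \<in> V" using V(2) by blast
  obtain K e where K: "compact K" "0 < e"
    "{g. \<forall>x\<in>K. cmod (entire_apply g x - entire_apply f x) < e} \<subseteq> V"
    using V(1) f by (rule entire.open_repE)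
  obtain g where g: "g \<in> S" "\<And>x. x \<in> K \<Longrightarrow> cmod (entire_apply f x - entire_apply g x) < e"
    using approximable_imageE[OF assms(1)[of f] _ K(2), of K] K(1) by blast
  from g(2) have "g \<in> V" by (intro subsetD[OF K(3)]) (simp add: norm_minus_commute)
  with g(1) show ?thesis ..
qed

text \<open>Coefficients from a countable dense set of complex numbers and exponents from \<open>D\<close> suffice, since
  \<open>c *\<^sub>C exp_entire x\<close> depends continuously on \<open>c\<close> and \<open>x\<close>.\<close>

lemma countable_dense_exponential_sums:
  fixes D :: "'f::{complex_lcs,metric_space} set"
  assumes AP: "approximation_property TYPE('f)" and D: "countable D" "closure D = UNIV"
  shows "\<exists>Q. countable Q \<and> Q \<subseteq> exp_span D \<and>
    (\<forall>f. entire_apply f \<in> uniformly_approximable (Collect compact) (entire_apply ` Q))"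
proof -
  obtain Z :: "complex set" where Z: "countable Z" "\<And>X. open X \<Longrightarrow> X \<noteq> {} \<Longrightarrow> \<exists>z\<in>Z. z \<in> X"
    using countable_dense_setE by blast
  define comb where "comb = (\<lambda>ps :: (complex \<times> 'f) list. \<Sum>(c, x)\<leftarrow>ps. c *\<^sub>C exp_entire x)"
  define Q where "Q = comb ` lists (Z \<times> D)"
  let ?M = "uniformly_approximable (Collect compact) (entire_apply ` Q)"
  have "countable Q" unfolding Q_def using Z(1) D(1) by (intro countable_image countable_lists countable_SIGMA)
  moreover have "comb ps \<in> exp_span D" if "ps \<in> lists (Z \<times> D)" for ps
    using that
  proof (induction ps rule: lists.induct)
    case (Cons p ps)
    then have "fst p *\<^sub>C exp_entire (snd p) \<in> exp_span D"
      by (intro complex_vector.span_scale complex_vector.span_base) auto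
    with Cons(3) show ?case
      by (auto simp: comb_def case_prod_unfold intro: complex_vector.span_add)
  qed (simp add: comb_def complex_vector.span_zero)
  moreover have comb: "entire_apply v \<in> ?M" if "v \<in> exp_span UNIV" for v
    using that
  proof (induction v rule: complex_vector.span_induct_alt)
    case base
    have "0 \<in> Q" unfolding Q_def by (rule image_eqI[of _ _ "[]"]) (auto simp: comb_def)
    then show ?case by (intro subsetD[OF uniformly_approximable_superset] imageI)
  next
    case (step c s v)
    then obtain x where x: "s = exp_entire x" by blast
    show ?case
      unfolding uniformly_approximable_def
    proof safe
      fix K :: "'f dual set" and e :: real assume K: "compact K" and "0 < e"
      then have e2: "0 < e / 2" by simp
      have lim: "((\<lambda>p. fst p *\<^sub>C exp_entire (snd p)) \<longlongrightarrow> c *\<^sub>C exp_entire x) (nhds c \<times>\<^sub>F nhds x)"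
        by (intro tendsto_scaleC tendsto_exp_entire filterlim_fst filterlim_snd)
      have "\<forall>\<^sub>F p in nhds c \<times>\<^sub>F nhds x. \<forall>\<phi>\<in>K.
          cmod (entire_apply (fst p *\<^sub>C exp_entire (snd p)) \<phi> - entire_apply (c *\<^sub>C s) \<phi>) < e / 2"
        using lim K e2 unfolding entire.tendsto_rep_iff x by blast
      then obtain P R where PR: "eventually P (nhds c)" "eventually R (nhds x)" "\<And>z d. P z \<Longrightarrow> R d \<Longrightarrow>
          \<forall>\<phi>\<in>K. cmod (entire_apply (z *\<^sub>C exp_entire d) \<phi> - entire_apply (c *\<^sub>C s) \<phi>) < e / 2"
        unfolding eventually_prod_filter by auto
      obtain z where z: "z \<in> Z" "P z"
        using PR(1) Z(2) unfolding eventually_nhds by blast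
      obtain d where d: "d \<in> D" "R d" using dense_eventually[OF D(2) PR(2)] by blast
      obtain ps where ps: "ps \<in> lists (Z \<times> D)"
        "\<And>\<phi>. \<phi> \<in> K \<Longrightarrow> cmod (entire_apply v \<phi> - entire_apply (comb ps) \<phi>) < e / 2"
      proof (rule approximable_imageE[OF step(2) _ e2])
        show "K \<in> Collect compact" using K by simp
      next
        fix q assume "q \<in> Q" "\<And>\<phi>. \<phi> \<in> K \<Longrightarrow> cmod (entire_apply v \<phi> - entire_apply q \<phi>) < e / 2"
        then show thesis using that unfolding Q_def by blast
      qed
      have "cmod (entire_apply (c *\<^sub>C s + v) \<phi> - entire_apply (comb ((z, d) # ps)) \<phi>) < e" if "\<phi> \<in> K" for \<phi>
      proof -
        have "cmod (entire_apply (c *\<^sub>C s) \<phi> - entire_apply (z *\<^sub>C exp_entire d) \<phi>) < e / 2"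
          using PR(3)[OF z(2) d(2)] that by (simp add: norm_minus_commute)
        with ps(2)[OF that] show ?thesis
          using norm_diff_triangle_ineq[of "entire_apply (c *\<^sub>C s) \<phi>" "entire_apply v \<phi>"
              "entire_apply (z *\<^sub>C exp_entire d) \<phi>" "entire_apply (comb ps) \<phi>"]
          by (simp add: comb_def entire.rep_add)
      qed
      moreover have "comb ((z, d) # ps) \<in> Q"
        unfolding Q_def using z(1) d(1) ps(1) by (intro imageI) auto
      ultimately show "\<exists>g\<in>entire_apply ` Q. \<forall>\<phi>\<in>K. cmod (entire_apply (c *\<^sub>C s + v) \<phi> - g \<phi>) < e"
        by (intro bexI[of _ "entire_apply (comb ((z, d) # ps))"]) auto
    qed
  qed
  moreover have "entire_apply f \<in> ?M" for f
  proof (rule uniformly_approximable_trans)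
    fix K :: "'f dual set" and e :: real assume K: "K \<in> Collect compact" and e: "0 < e"
    obtain v where "v \<in> exp_span UNIV" "\<And>\<phi>. \<phi> \<in> K \<Longrightarrow> cmod (entire_apply f \<phi> - entire_apply v \<phi>) < e"
      using approximable_imageE[OF exponentials_dense[OF AP, of f] K e] by blast
    then show "\<exists>g\<in>?M. \<forall>\<phi>\<in>K. cmod (entire_apply f \<phi> - g \<phi>) < e"
      by (intro bexI[OF _ comb] ballI)
  qed
  ultimately show ?thesis by (intro exI[of _ Q] conjI allI) (auto simp: Q_def)
qed

section \<open>The symbol of a convolution operator\<close>

text \<open>The eigenvalue of \<open>exp_entire x\<close>, see \<open>convolution_operator_exp\<close>.\<close>

definition symbol :: "('f::complex_lcs dual entire \<Rightarrow> 'f dual entire) \<Rightarrow> 'f \<Rightarrow> complex"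
  where "symbol L x = entire_apply (L (exp_entire x)) 0"

lemma clinear_add: "clinear L \<Longrightarrow> L (f + g) = L f + L g"
  and clinear_scale: "clinear L \<Longrightarrow> L (c *\<^sub>C f) = c *\<^sub>C L f"
  by (simp_all add: clinear_iff)

lemma clinear_0: "clinear L \<Longrightarrow> L 0 = 0"
  using clinear_scale[of L 0 0] by simp

lemma clinear_diff: "clinear L \<Longrightarrow> L (f - g) = L f - L g"
  using clinear_add[of L "f - g" g] by simp

lemma clinear_funpow:
  fixes L :: "'a::complex_vector \<Rightarrow> 'a"
  shows "clinear L \<Longrightarrow> clinear (L ^^ n)"
  by (induction n) (auto simp: clinear_iff)

lemma convolution_operatorD:
  assumes "convolution_operator L"
  shows "clinear L" "continuous_on UNIV L" "L (translate a f) = translate a (L f)"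
  using assms unfolding convolution_operator_def by auto

text \<open>Since \<open>translate (- \<phi>) (exp_entire x) = exp (\<phi> x) *\<^sub>C exp_entire x\<close>, applying \<open>L\<close> and evaluating at \<open>0\<close>
  yields \<open>L (exp_entire x) \<phi> = exp (\<phi> x) * L (exp_entire x) 0\<close>.\<close>

lemma convolution_operator_exp:
  assumes L: "convolution_operator L"
  shows "L (exp_entire x) = symbol L x *\<^sub>C exp_entire x"
proof (rule entire.rep_inject, rule ext)
  fix \<phi>
  have "translate (- \<phi>) (exp_entire x) = exp (dual_apply \<phi> x) *\<^sub>C exp_entire x"
    by (rule entire.rep_inject)
      (simp add: fun_eq_iff translate_apply entire.rep_scaleC exp_entire.rep_eq dual.rep_add
        exp_add mult.commute)
  then have "translate (- \<phi>) (L (exp_entire x)) = exp (dual_apply \<phi> x) *\<^sub>C L (exp_entire x)"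
    using convolution_operatorD(3)[OF L, of "- \<phi>" "exp_entire x"]
      clinear_scale[OF convolution_operatorD(1)[OF L]] by simp
  then have "entire_apply (translate (- \<phi>) (L (exp_entire x))) 0 =
      entire_apply (exp (dual_apply \<phi> x) *\<^sub>C L (exp_entire x)) 0" by simp
  then show "entire_apply (L (exp_entire x)) \<phi> = entire_apply (symbol L x *\<^sub>C exp_entire x) \<phi>"
    by (simp add: translate_apply entire.rep_scaleC exp_entire.rep_eq symbol_def mult.commute)
qed

lemma convolution_operator_funpow_exp:
  assumes L: "convolution_operator L"
  shows "(L ^^ n) (exp_entire x) = symbol L x ^ n *\<^sub>C exp_entire x"
proof (induction n)
  case (Suc n)
  then show ?case
    by (simp add: clinear_scale[OF convolution_operatorD(1)[OF L]] convolution_operator_exp[OF L]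
        scaleC_scaleC mult.commute)
qed (simp add: scaleC_one)

lemma continuous_on_symbol:
  fixes L :: "'f::{complex_lcs,metric_space} dual entire \<Rightarrow> 'f dual entire"
  assumes L: "convolution_operator L"
  shows "continuous_on UNIV (symbol L)"
  unfolding continuous_on_def symbol_def
proof
  fix x :: 'f
  have "((\<lambda>x. L (exp_entire x)) \<longlongrightarrow> L (exp_entire x)) (at x)"
    by (rule continuous_on_tendsto_compose[OF convolution_operatorD(2)[OF L]
          tendsto_exp_entire[OF tendsto_ident_at]]) auto
  then show "((\<lambda>x. entire_apply (L (exp_entire x)) 0) \<longlongrightarrow> entire_apply (L (exp_entire x)) 0) (at x)"
    by (rule entire.tendsto_evaluation)
qed

text \<open>The Taylor remainder of order two is \<open>O(|h|\<^sup>2)\<close> uniformly on compact sets.\<close>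

lemma exp_entire_derivative:
  fixes a y :: "'f::complex_lcs"
  shows "((\<lambda>h. inverse h *\<^sub>C (exp_entire (a + h *\<^sub>C y) - exp_entire a)) \<longlongrightarrow> monomial_exp_entire y a) (at 0)"
  unfolding entire.tendsto_rep_iff
proof (intro allI impI)
  fix K :: "'f dual set" and e :: real assume K: "compact K" and e: "0 < e"
  obtain A where A: "\<And>\<phi>. \<phi> \<in> K \<Longrightarrow> cmod (dual_apply \<phi> a) \<le> A"
    using compact_dual_bounded[OF K] by blast
  obtain B where B: "\<And>\<phi>. \<phi> \<in> K \<Longrightarrow> cmod (dual_apply \<phi> y) \<le> B"
    using compact_dual_bounded[OF K] by blast
  define M where "M = exp (A + 1 * B)"
  have M: "0 < M" by (simp add: M_def)
  define d where "d = min (1 / 2) (e / (2 * M))"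
  have d: "0 < d" using e M by (simp add: d_def)
  have "\<forall>\<^sub>F h in at 0. h \<noteq> 0 \<and> cmod h < d"
    using d by (auto simp: eventually_at)
  then show "\<forall>\<^sub>F h in at 0. \<forall>\<phi>\<in>K. cmod (entire_apply (inverse h *\<^sub>C (exp_entire (a + h *\<^sub>C y) - exp_entire a)) \<phi> -
      entire_apply (monomial_exp_entire y a) \<phi>) < e"
  proof eventually_elim
    case (elim h)
    show ?case
    proof
      fix \<phi> assume \<phi>: "\<phi> \<in> K"
      define g where "g = (\<lambda>z. exp (dual_apply \<phi> (a + z *\<^sub>C y)))"
      have bound: "cmod (g w - (\<Sum>k<2. taylor_coeff g k * w ^ k)) \<le> 2 * M * (cmod w / 1) ^ 2"
        if "cmod w \<le> 1 / 2" for w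
        unfolding g_def M_def
        using that A[OF \<phi>] B[OF \<phi>]
        by (intro taylor_remainder_bound[OF exp_line_holomorphic] exp_line_bounds) auto
      have "(\<Sum>k<2. taylor_coeff g k * h ^ k) =
          exp (dual_apply \<phi> a) + dual_apply \<phi> y * exp (dual_apply \<phi> a) * h"
        unfolding g_def by (simp add: numeral_2_eq_2 exp_line_taylor_coeff)
      then have "entire_apply (inverse h *\<^sub>C (exp_entire (a + h *\<^sub>C y) - exp_entire a)) \<phi> -
          entire_apply (monomial_exp_entire y a) \<phi> = inverse h * (g h - (\<Sum>k<2. taylor_coeff g k * h ^ k))"
        using elim by (simp add: entire.rep_scaleC entire.rep_diff exp_entire.rep_eq
            monomial_exp_entire.rep_eq g_def field_simps)
      also have "cmod \<dots> = inverse (cmod h) * cmod (g h - (\<Sum>k<2. taylor_coeff g k * h ^ k))"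
        by (simp only: norm_mult norm_inverse)
      also have "\<dots> \<le> inverse (cmod h) * (2 * M * (cmod h / 1) ^ 2)"
        using elim by (intro mult_left_mono bound) (auto simp: d_def)
      also have "\<dots> = 2 * M * cmod h" using elim by (simp add: power2_eq_square)
      also have "\<dots> < 2 * M * (e / (2 * M))"
        using elim M by (intro mult_strict_left_mono) (auto simp: d_def)
      also have "\<dots> = e" using M by simp
      finally show "cmod (entire_apply (inverse h *\<^sub>C (exp_entire (a + h *\<^sub>C y) - exp_entire a)) \<phi> -
          entire_apply (monomial_exp_entire y a) \<phi>) < e" .
    qed
  qed
qed

lemma symbol_line_holomorphic:
  fixes L :: "'f::complex_lcs dual entire \<Rightarrow> 'f dual entire"
  assumes L: "convolution_operator L"
  shows "(\<lambda>z. symbol L (a + z *\<^sub>C y)) holomorphic_on UNIV"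
proof -
  note lin = convolution_operatorD(1)[OF L]
  have "((\<lambda>z. symbol L (a + z *\<^sub>C y)) has_field_derivative
      entire_apply (L (monomial_exp_entire y (a + z *\<^sub>C y))) 0) (at z)" for z
    unfolding DERIV_def
  proof -
    let ?b = "a + z *\<^sub>C y"
    have "((\<lambda>h. L (inverse h *\<^sub>C (exp_entire (?b + h *\<^sub>C y) - exp_entire ?b))) \<longlongrightarrow>
        L (monomial_exp_entire y ?b)) (at 0)"
      by (rule continuous_on_tendsto_compose[OF convolution_operatorD(2)[OF L] exp_entire_derivative]) auto
    from entire.tendsto_evaluation[OF this, of 0]
    show "((\<lambda>h. (symbol L (a + (z + h) *\<^sub>C y) - symbol L (a + z *\<^sub>C y)) / h) \<longlongrightarrow>
        entire_apply (L (monomial_exp_entire y (a + z *\<^sub>C y))) 0) (at 0)"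
      by (simp add: clinear_scale[OF lin] clinear_diff[OF lin] entire.rep_scaleC entire.rep_diff
          symbol_def divide_inverse mult.commute scaleC_add_left add.assoc)
  qed
  then show ?thesis unfolding holomorphic_on_def field_differentiable_def by blast
qed

text \<open>If the symbol were constant, \<open>L\<close> would be a multiple of the identity on the dense span of the
  exponentials, and therefore everywhere.\<close>

lemma symbol_not_constant:
  fixes L :: "'f::{complex_lcs,metric_space} dual entire \<Rightarrow> 'f dual entire"
  assumes AP: "approximation_property TYPE('f)"
    and L: "convolution_operator L" "nontrivial_operator L"
  shows "\<exists>x y. symbol L x \<noteq> symbol L y"
proof (rule ccontr)
  assume "\<not> ?thesis"
  then obtain c where c: "\<And>x. symbol L x = c" by metis
  note lin = convolution_operatorD(1)[OF L(1)]
  have span: "L v = c *\<^sub>C v" if "v \<in> exp_span UNIV" for v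
    using that
  proof (induction v rule: complex_vector.span_induct_alt)
    case base
    show ?case by (simp add: clinear_0[OF lin])
  next
    case (step b s v)
    then show ?case
      by (auto simp: clinear_add[OF lin] clinear_scale[OF lin] convolution_operator_exp[OF L(1)] c
          scaleC_add_right scaleC_scaleC mult.commute)
  qed
  have "open {f. L f \<noteq> c *\<^sub>C f}"
    by (intro open_Collect_neq convolution_operatorD(2)[OF L(1)] continuous_on_scaleC continuous_intros)
  moreover have "{f. L f \<noteq> c *\<^sub>C f} \<noteq> {}"
    using L(2) unfolding nontrivial_operator_def by blast
  ultimately obtain g where "g \<in> exp_span UNIV" "L g \<noteq> c *\<^sub>C g"
    using approximable_meets_open[OF exponentials_dense[OF AP]] by blast
  then show False using span by blast
qed

text \<open>Liouville's theorem, applied to \<open>g\<close> and to \<open>1 / g\<close>.\<close>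

lemma nonconstant_entire_small_and_large:
  assumes g: "g holomorphic_on UNIV" and "g a \<noteq> g b"
  shows "\<exists>z. cmod (g z) < 1" "\<exists>z. 1 < cmod (g z)"
proof -
  show "\<exists>z. 1 < cmod (g z)"
  proof (rule ccontr)
    assume "\<not> ?thesis"
    then have "bounded (range g)" by (auto simp: bounded_iff not_less)
    then have "g constant_on UNIV" by (rule Liouville_theorem[OF g])
    then show False using assms(2) unfolding constant_on_def by (metis UNIV_I)
  qed
  show "\<exists>z. cmod (g z) < 1"
  proof (rule ccontr)
    assume "\<not> ?thesis"
    then have ge: "1 \<le> cmod (g z)" for z by (simp add: not_less)
    then have nz: "g z \<noteq> 0" for z by (metis norm_zero not_one_le_zero)
    have "(\<lambda>z. inverse (g z)) holomorphic_on UNIV" using g nz by (intro holomorphic_intros)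
    moreover have "bounded (range (\<lambda>z. inverse (g z)))"
      using ge by (auto simp: bounded_iff norm_inverse intro!: exI[of _ 1] inverse_le_1_iff[THEN iffD2])
    ultimately have "(\<lambda>z. inverse (g z)) constant_on UNIV" by (rule Liouville_theorem)
    then show False using assms(2) unfolding constant_on_def by (metis UNIV_I inverse_inverse_eq)
  qed
qed

lemma symbol_small_and_large:
  fixes L :: "'f::{complex_lcs,metric_space} dual entire \<Rightarrow> 'f dual entire"
  assumes "approximation_property TYPE('f)"
    and "convolution_operator L" "nontrivial_operator L"
  shows "\<exists>x. cmod (symbol L x) < 1" "\<exists>x. 1 < cmod (symbol L x)"
proof -
  obtain x y where ne: "symbol L x \<noteq> symbol L y" using symbol_not_constant[OF assms] by blast
  define g where "g = (\<lambda>z. symbol L (x + z *\<^sub>C (y - x)))"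
  have "g 0 \<noteq> g 1" using ne by (simp add: g_def scaleC_one)
  moreover have "g holomorphic_on UNIV"
    unfolding g_def by (rule symbol_line_holomorphic[OF assms(2)])
  ultimately have "\<exists>z. cmod (g z) < 1" "\<exists>z. 1 < cmod (g z)"
    using nonconstant_entire_small_and_large by blast+
  then show "\<exists>x. cmod (symbol L x) < 1" "\<exists>x. 1 < cmod (symbol L x)"
    unfolding g_def by blast+
qed

section \<open>Orbits of exponential sums\<close>

text \<open>Continuity of \<open>L\<close> in the compact-open topology controls \<open>L g\<close> at \<open>0\<close> by the values of \<open>g\<close> on a compact set,
  which lies in some \<open>dual_ball C n\<close>.  Since \<open>L\<close> commutes with translations, \<open>L g\<close> is controlled at every \<open>\<phi> \<in> dual_ball C r\<close>
  by the values of \<open>g\<close> on \<open>dual_ball C (n + r)\<close>.\<close>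

lemma convolution_operator_dual_ball:
  assumes L: "convolution_operator L" and C: "compact C" and e: "0 < e"
  shows "\<exists>s d. 0 < d \<and> (\<forall>g. (\<forall>\<phi>\<in>dual_ball C s. cmod (entire_apply g \<phi>) < d) \<longrightarrow>
    (\<forall>\<phi>\<in>dual_ball C r. cmod (entire_apply (L g) \<phi>) < e))"
proof -
  note lin = convolution_operatorD(1)[OF L]
  have "open (L -` {h. \<forall>x\<in>{0}. cmod (entire_apply h x - entire_apply 0 x) < e})"
    by (intro open_vimage[OF _ convolution_operatorD(2)[OF L]] entire.open_basic e) simp
  moreover have "0 \<in> L -` {h. \<forall>x\<in>{0}. cmod (entire_apply h x - entire_apply 0 x) < e}"
    using e by (simp add: clinear_0[OF lin])
  ultimately obtain K d where K: "compact K" "0 < d"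
    "{g. \<forall>x\<in>K. cmod (entire_apply g x - entire_apply 0 x) < d} \<subseteq>
      L -` {h. \<forall>x\<in>{0}. cmod (entire_apply h x - entire_apply 0 x) < e}"
    by (rule entire.open_repE)
  obtain n where n: "K \<subseteq> dual_ball C (real n)" using compact_subset_dual_ball[OF C K(1)] by blast
  have "cmod (entire_apply (L g) \<phi>) < e"
    if g: "\<forall>\<psi>\<in>dual_ball C (real n + r). cmod (entire_apply g \<psi>) < d" and \<phi>: "\<phi> \<in> dual_ball C r" for g \<phi>
  proof -
    have "cmod (entire_apply (translate (- \<phi>) g) \<psi>) < d" if "\<psi> \<in> K" for \<psi>
    proof -
      have "\<psi> + \<phi> \<in> dual_ball C (real n + r)" using n that \<phi> by (intro dual_ball_add) auto
      then show ?thesis using g by (simp add: translate_apply)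
    qed
    then have "translate (- \<phi>) g \<in> L -` {h. \<forall>x\<in>{0}. cmod (entire_apply h x - entire_apply 0 x) < e}"
      by (intro subsetD[OF K(3)]) (simp add: entire.rep_zero)
    then have "cmod (entire_apply (L (translate (- \<phi>) g)) 0) < e" by (simp add: entire.rep_zero)
    then show ?thesis by (simp add: convolution_operatorD(3)[OF L] translate_apply)
  qed
  with K(2) show ?thesis by blast
qed

lemma convolution_operator_powers_dual_ball:
  assumes L: "convolution_operator L" and C: "compact C" and e: "0 < e"
  shows "\<exists>s d. 0 < d \<and> (\<forall>g. (\<forall>\<phi>\<in>dual_ball C s. cmod (entire_apply g \<phi>) < d) \<longrightarrow>
    (\<forall>m\<le>N. \<forall>\<phi>\<in>dual_ball C r. cmod (entire_apply ((L ^^ m) g) \<phi>) < e))"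
  using e
proof (induction N arbitrary: r e)
  case 0
  show ?case by (rule exI[of _ r], rule exI[of _ e]) (use 0 in simp)
next
  case (Suc N)
  obtain s1 d1 where 1: "0 < d1" "\<And>g. (\<forall>\<phi>\<in>dual_ball C s1. cmod (entire_apply g \<phi>) < d1) \<Longrightarrow>
      \<forall>\<phi>\<in>dual_ball C r. cmod (entire_apply (L g) \<phi>) < e"
    using convolution_operator_dual_ball[OF L C Suc.prems, of r] by blast
  obtain s2 d2 where 2: "0 < d2" "\<And>g. (\<forall>\<phi>\<in>dual_ball C s2. cmod (entire_apply g \<phi>) < d2) \<Longrightarrow>
      \<forall>m\<le>N. \<forall>\<phi>\<in>dual_ball C (max r s1). cmod (entire_apply ((L ^^ m) g) \<phi>) < min e d1"
    using Suc.IH[of "min e d1" "max r s1"] Suc.prems 1(1) by auto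
  show ?case
  proof (rule exI[of _ s2], rule exI[of _ d2], intro conjI allI impI ballI)
    show "0 < d2" by (rule 2(1))
    fix g m \<phi>
    assume g: "\<forall>\<phi>\<in>dual_ball C s2. cmod (entire_apply g \<phi>) < d2" and m: "m \<le> Suc N" and \<phi>: "\<phi> \<in> dual_ball C r"
    have small: "cmod (entire_apply ((L ^^ k) g) \<psi>) < min e d1" if "k \<le> N" "\<psi> \<in> dual_ball C (max r s1)" for k \<psi>
      using 2(2)[OF g] that by blast
    show "cmod (entire_apply ((L ^^ m) g) \<phi>) < e"
    proof (cases "m \<le> N")
      case True
      have "\<phi> \<in> dual_ball C (max r s1)" using \<phi> dual_ball_mono[of r "max r s1" C] by auto
      from small[OF True this] show ?thesis by simp
    next
      case False
      then have m: "(L ^^ m) g = L ((L ^^ N) g)" using m by (simp add: le_Suc_eq)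
      have "\<forall>\<psi>\<in>dual_ball C s1. cmod (entire_apply ((L ^^ N) g) \<psi>) < d1"
        using small[OF order_refl] dual_ball_mono[of s1 "max r s1" C] by auto
      from 1(2)[OF this] \<phi> show ?thesis unfolding m by blast
    qed
  qed
qed

definition null_sequence :: "'f::complex_lcs set \<Rightarrow> (nat \<Rightarrow> 'f dual entire) \<Rightarrow> bool"
  where "null_sequence C w \<longleftrightarrow>
    (\<forall>r. \<forall>e>0. \<forall>\<^sub>F n in sequentially. \<forall>\<phi>\<in>dual_ball C r. cmod (entire_apply (w n) \<phi>) < e)"

lemma null_sequenceD:
  "null_sequence C w \<Longrightarrow> 0 < e \<Longrightarrow> \<forall>\<^sub>F n in sequentially. \<forall>\<phi>\<in>dual_ball C r. cmod (entire_apply (w n) \<phi>) < e"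
  unfolding null_sequence_def by blast

lemma null_sequence_0: "null_sequence C (\<lambda>n. 0)"
  unfolding null_sequence_def by (simp add: entire.rep_zero)

lemma null_sequence_add:
  assumes "null_sequence C u" "null_sequence C v"
  shows "null_sequence C (\<lambda>n. u n + v n)"
  unfolding null_sequence_def
proof (intro allI impI)
  fix r and e :: real assume "0 < e"
  then have e2: "0 < e / 2" by simp
  from null_sequenceD[OF assms(1) e2, of r] null_sequenceD[OF assms(2) e2, of r]
  show "\<forall>\<^sub>F n in sequentially. \<forall>\<phi>\<in>dual_ball C r. cmod (entire_apply (u n + v n) \<phi>) < e"
  proof eventually_elim
    case (elim n)
    show ?case
    proof
      fix \<phi> assume "\<phi> \<in> dual_ball C r"
      with elim have "cmod (entire_apply (u n) \<phi>) < e / 2" "cmod (entire_apply (v n) \<phi>) < e / 2" by blast+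
      then show "cmod (entire_apply (u n + v n) \<phi>) < e"
        unfolding entire.rep_add using norm_add_less by fastforce
    qed
  qed
qed

lemma null_sequence_exp:
  assumes x: "x \<in> bounded_vectors C" and a: "a \<longlonglongrightarrow> 0"
  shows "null_sequence C (\<lambda>n. a n *\<^sub>C exp_entire x)"
  unfolding null_sequence_def
proof (intro allI impI)
  fix r and e :: real assume e: "0 < e"
  obtain M where M: "\<And>\<phi>. \<phi> \<in> dual_ball C r \<Longrightarrow> cmod (dual_apply \<phi> x) \<le> M"
    using x unfolding bounded_vectors_def by blast
  have "\<forall>\<^sub>F n in sequentially. cmod (a n) < e / exp M"
    using tendstoD[OF a, of "e / exp M"] e by simp
  then show "\<forall>\<^sub>F n in sequentially. \<forall>\<phi>\<in>dual_ball C r. cmod (entire_apply (a n *\<^sub>C exp_entire x) \<phi>) < e"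
  proof eventually_elim
    case (elim n)
    show ?case
    proof
      fix \<phi> assume \<phi>: "\<phi> \<in> dual_ball C r"
      have "cmod (exp (dual_apply \<phi> x)) \<le> exp M"
        using order_trans[OF complex_Re_le_cmod M[OF \<phi>]] by simp
      then have "cmod (a n) * cmod (exp (dual_apply \<phi> x)) \<le> cmod (a n) * exp M"
        by (rule mult_left_mono) simp
      also have "\<dots> < e" using elim by (simp add: field_simps)
      finally show "cmod (entire_apply (a n *\<^sub>C exp_entire x) \<phi>) < e"
        by (simp add: entire.rep_scaleC exp_entire.rep_eq norm_mult)
    qed
  qed
qed

text \<open>\<open>L ^^ n\<close> multiplies the coefficient of \<open>exp_entire x\<close> by \<open>symbol L x ^ n\<close>.\<close>

lemma forward_orbit_null:
  assumes L: "convolution_operator L"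
    and v: "v \<in> exp_span (bounded_vectors C \<inter> {x. cmod (symbol L x) < 1})"
  shows "null_sequence C (\<lambda>n. (L ^^ n) v)"
  using v
proof (induction v rule: complex_vector.span_induct_alt)
  case base
  show ?case
    by (simp add: clinear_0[OF clinear_funpow[OF convolution_operatorD(1)[OF L]]] null_sequence_0)
next
  case (step c s v)
  then obtain x where x: "s = exp_entire x" "x \<in> bounded_vectors C" "cmod (symbol L x) < 1" by blast
  note lin = clinear_funpow[OF convolution_operatorD(1)[OF L]]
  have "(\<lambda>n. c * symbol L x ^ n) \<longlonglongrightarrow> c * 0"
    by (intro tendsto_intros LIMSEQ_power_zero x(3))
  then have "null_sequence C (\<lambda>n. (c * symbol L x ^ n) *\<^sub>C exp_entire x)"
    by (intro null_sequence_exp x(2)) simp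
  from null_sequence_add[OF this step(2)] show ?case
    by (simp add: x(1) clinear_add[OF lin] clinear_scale[OF lin] convolution_operator_funpow_exp[OF L]
        scaleC_scaleC)
qed

text \<open>Divide the coefficient of \<open>exp_entire x\<close> by \<open>symbol L x ^ n\<close>.\<close>

lemma backward_orbit_null:
  assumes L: "convolution_operator L"
    and v: "v \<in> exp_span (bounded_vectors C \<inter> {x. 1 < cmod (symbol L x)})"
  shows "\<exists>w. (\<forall>n. (L ^^ n) (w n) = v \<and> w n \<in> exp_span (bounded_vectors C)) \<and> null_sequence C w"
  using v
proof (induction v rule: complex_vector.span_induct_alt)
  case base
  show ?case
    by (intro exI[of _ "\<lambda>n. 0"])
      (simp add: clinear_0[OF clinear_funpow[OF convolution_operatorD(1)[OF L]]] null_sequence_0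
        complex_vector.span_zero)
next
  case (step c s v)
  then obtain x where x: "s = exp_entire x" "x \<in> bounded_vectors C" "1 < cmod (symbol L x)" by blast
  obtain w where w: "\<And>n. (L ^^ n) (w n) = v" "\<And>n. w n \<in> exp_span (bounded_vectors C)" "null_sequence C w"
    using step(2) by blast
  note lin = clinear_funpow[OF convolution_operatorD(1)[OF L]]
  have nz: "symbol L x \<noteq> 0" using x(3) by auto
  have "cmod (inverse (symbol L x)) < 1"
    using x(3) by (simp add: norm_inverse inverse_less_1_iff)
  then have "(\<lambda>n. c * inverse (symbol L x) ^ n) \<longlonglongrightarrow> c * 0"
    by (intro tendsto_intros LIMSEQ_power_zero)
  then have "null_sequence C (\<lambda>n. (c * inverse (symbol L x) ^ n) *\<^sub>C exp_entire x)"
    by (intro null_sequence_exp x(2)) simp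
  then have "null_sequence C (\<lambda>n. (c * inverse (symbol L x) ^ n) *\<^sub>C exp_entire x + w n)"
    using w(3) by (rule null_sequence_add)
  moreover have "(L ^^ n) ((c * inverse (symbol L x) ^ n) *\<^sub>C exp_entire x + w n) = c *\<^sub>C s + v" for n
    using nz by (simp add: x(1) w(1) clinear_add[OF lin] clinear_scale[OF lin]
        convolution_operator_funpow_exp[OF L] scaleC_scaleC power_inverse mult.assoc)
  moreover have "(c * inverse (symbol L x) ^ n) *\<^sub>C exp_entire x + w n \<in> exp_span (bounded_vectors C)" for n
    using x(2) by (intro complex_vector.span_add[OF _ w(2)] complex_vector.span_scale complex_vector.span_base) auto
  ultimately show ?case by (intro exI[of _ "\<lambda>n. (c * inverse (symbol L x) ^ n) *\<^sub>C exp_entire x + w n"]) auto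
qed

lemma exp_span_approximable:
  assumes U: "open U" "x \<in> U" "x \<in> bounded_vectors C" and v: "v \<in> exp_span (bounded_vectors C)" and e: "0 < e"
  obtains u where "u \<in> exp_span (bounded_vectors C \<inter> U)"
    "\<And>\<phi>. \<phi> \<in> dual_ball C r \<Longrightarrow> cmod (entire_apply (v - u) \<phi>) < e"
proof -
  have "entire_apply v \<in>
      uniformly_approximable (range (dual_ball C)) (entire_apply ` exp_span (bounded_vectors C \<inter> U))"
    by (rule span_approximableI[OF function_subspace_span _ v])
      (use exp_bounded_vectors_approximable[OF U] in auto)
  then show thesis
    using approximable_imageE[OF _ rangeI e, of "entire_apply v" "dual_ball C" entire_apply _ r] that
    unfolding entire.rep_diff by blast
qed

text \<open>Choose \<open>y\<close> close to \<open>q\<close> with a null backward orbit \<open>w\<close>, and \<open>v' = v + x\<close> with \<open>x\<close> close to \<open>w n\<close>.  Then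
  \<open>v' - v\<close> is small, and \<open>(L ^^ n) v'\<close> is the sum of \<open>(L ^^ n) v\<close>, which is small, and of a function
  close to \<open>(L ^^ n) (w n) = y\<close>.  The exact function \<open>w n\<close> is replaced by \<open>x\<close> in order that \<open>v'\<close>
  again has a null orbit, so that the step can be repeated.  The powers up to \<open>N\<close> of \<open>v' - v\<close> are kept small so
  that later steps do not spoil what earlier ones have achieved.\<close>

lemma transitivity_step:
  fixes C :: "'f::{complex_lcs,metric_space} set"
  assumes L: "convolution_operator L" and C: "compact C"
    and a: "a \<in> bounded_vectors C" "cmod (symbol L a) < 1"
    and b: "b \<in> bounded_vectors C" "1 < cmod (symbol L b)"
    and v: "v \<in> exp_span (bounded_vectors C \<inter> {x. cmod (symbol L x) < 1})"
    and q: "q \<in> exp_span (bounded_vectors C)" and e: "0 < e"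
  shows "\<exists>n0. \<forall>n\<ge>n0. \<exists>v'\<in>exp_span (bounded_vectors C \<inter> {x. cmod (symbol L x) < 1}).
    (\<forall>m\<le>N. \<forall>\<phi>\<in>dual_ball C r. cmod (entire_apply ((L ^^ m) (v' - v)) \<phi>) < e) \<and>
    (\<forall>\<phi>\<in>dual_ball C r. cmod (entire_apply ((L ^^ n) v' - q) \<phi>) < e)"
proof -
  note lin = clinear_funpow[OF convolution_operatorD(1)[OF L]]
  have cont: "continuous_on UNIV (\<lambda>x. cmod (symbol L x))"
    by (intro continuous_intros continuous_on_symbol[OF L])
  have small: "open {x. cmod (symbol L x) < 1}" and large: "open {x. 1 < cmod (symbol L x)}"
    by (intro open_Collect_less cont continuous_intros)+
  have e4: "0 < e / 4" using e by simp
  obtain y where y: "y \<in> exp_span (bounded_vectors C \<inter> {x. 1 < cmod (symbol L x)})"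
    "\<And>\<phi>. \<phi> \<in> dual_ball C r \<Longrightarrow> cmod (entire_apply (q - y) \<phi>) < e / 4"
    using exp_span_approximable[OF large _ b(1) q e4, of r] b(2) by blast
  obtain w where w: "\<And>n. (L ^^ n) (w n) = y" "\<And>n. w n \<in> exp_span (bounded_vectors C)" "null_sequence C w"
    using backward_orbit_null[OF L y(1)] by blast
  obtain s d where sd: "0 < d" "\<And>g. (\<forall>\<phi>\<in>dual_ball C s. cmod (entire_apply g \<phi>) < d) \<Longrightarrow>
      \<forall>m\<le>N. \<forall>\<phi>\<in>dual_ball C r. cmod (entire_apply ((L ^^ m) g) \<phi>) < e / 4"
    using convolution_operator_powers_dual_ball[OF L C e4, of N r] by blast
  have "\<forall>\<^sub>F n in sequentially. (\<forall>\<phi>\<in>dual_ball C s. cmod (entire_apply (w n) \<phi>) < d) \<and>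
      (\<forall>\<phi>\<in>dual_ball C r. cmod (entire_apply ((L ^^ n) v) \<phi>) < e / 4)"
    by (intro eventually_conj null_sequenceD[OF w(3) sd(1)] null_sequenceD[OF forward_orbit_null[OF L v] e4])
  then obtain n0 where n0: "\<And>n. n \<ge> n0 \<Longrightarrow> \<forall>\<phi>\<in>dual_ball C s. cmod (entire_apply (w n) \<phi>) < d"
    "\<And>n \<phi>. n \<ge> n0 \<Longrightarrow> \<phi> \<in> dual_ball C r \<Longrightarrow> cmod (entire_apply ((L ^^ n) v) \<phi>) < e / 4"
    unfolding eventually_sequentially by blast
  show ?thesis
  proof (intro exI[of _ n0] allI impI)
    fix n assume n: "n0 \<le> n"
    obtain s' d' where sd': "0 < d'" "\<And>g. (\<forall>\<phi>\<in>dual_ball C s'. cmod (entire_apply g \<phi>) < d') \<Longrightarrow>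
        \<forall>m\<le>max N n. \<forall>\<phi>\<in>dual_ball C r. cmod (entire_apply ((L ^^ m) g) \<phi>) < e / 4"
      using convolution_operator_powers_dual_ball[OF L C e4, of "max N n" r] by blast
    obtain x where x: "x \<in> exp_span (bounded_vectors C \<inter> {x. cmod (symbol L x) < 1})"
      "\<And>\<phi>. \<phi> \<in> dual_ball C s' \<Longrightarrow> cmod (entire_apply (w n - x) \<phi>) < d'"
      using exp_span_approximable[OF small _ a(1) w(2)[of n] sd'(1), of s'] a(2) by blast
    have err: "cmod (entire_apply ((L ^^ m) (w n - x)) \<phi>) < e / 4" if "m \<le> max N n" "\<phi> \<in> dual_ball C r" for m \<phi>
      using sd'(2)[of "w n - x"] x(2) that by blast
    show "\<exists>v'\<in>exp_span (bounded_vectors C \<inter> {x. cmod (symbol L x) < 1}).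
      (\<forall>m\<le>N. \<forall>\<phi>\<in>dual_ball C r. cmod (entire_apply ((L ^^ m) (v' - v)) \<phi>) < e) \<and>
      (\<forall>\<phi>\<in>dual_ball C r. cmod (entire_apply ((L ^^ n) v' - q) \<phi>) < e)"
    proof (intro bexI[of _ "v + x"] conjI allI impI ballI)
      show "v + x \<in> exp_span (bounded_vectors C \<inter> {x. cmod (symbol L x) < 1})"
        using v x(1) by (rule complex_vector.span_add)
      fix \<phi> assume \<phi>: "\<phi> \<in> dual_ball C r"
      show "cmod (entire_apply ((L ^^ m) (v + x - v)) \<phi>) < e" if "m \<le> N" for m
      proof -
        have "cmod (entire_apply ((L ^^ m) (w n)) \<phi>) < e / 4"
          using sd(2)[OF n0(1)[OF n]] that \<phi> by blast
        moreover have "cmod (entire_apply ((L ^^ m) (w n - x)) \<phi>) < e / 4"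
          using that \<phi> by (intro err) auto
        moreover have eq: "entire_apply ((L ^^ m) (v + x - v)) \<phi> =
            entire_apply ((L ^^ m) (w n)) \<phi> - entire_apply ((L ^^ m) (w n - x)) \<phi>"
          by (simp add: clinear_diff[OF lin] entire.rep_diff)
        ultimately show ?thesis
          unfolding eq using norm_triangle_ineq4[of "entire_apply ((L ^^ m) (w n)) \<phi>" "entire_apply ((L ^^ m) (w n - x)) \<phi>"] e
          by linarith
      qed
      have eq: "entire_apply ((L ^^ n) (v + x) - q) \<phi> = entire_apply ((L ^^ n) v) \<phi> -
          (entire_apply (q - y) \<phi> + entire_apply ((L ^^ n) (w n - x)) \<phi>)"
        by (simp add: clinear_diff[OF lin] clinear_add[OF lin] entire.rep_diff entire.rep_add w(1))
      have "cmod (entire_apply ((L ^^ n) (w n - x)) \<phi>) < e / 4"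
        using \<phi> by (intro err) auto
      then show "cmod (entire_apply ((L ^^ n) (v + x) - q) \<phi>) < e"
        unfolding eq using n0(2)[OF n \<phi>] y(2)[OF \<phi>] e
          norm_triangle_ineq4[of "entire_apply ((L ^^ n) v) \<phi>"
            "entire_apply (q - y) \<phi> + entire_apply ((L ^^ n) (w n - x)) \<phi>"]
          norm_triangle_ineq[of "entire_apply (q - y) \<phi>" "entire_apply ((L ^^ n) (w n - x)) \<phi>"]
        by linarith
    qed
  qed
qed

section \<open>Limits of exponential sums\<close>

lemma geometric_step_bound:
  fixes a :: "nat \<Rightarrow> complex"
  assumes "\<And>i. N \<le> i \<Longrightarrow> cmod (a (Suc i) - a i) \<le> (1 / 2) ^ i" and "N \<le> k"
  shows "cmod (a k - a N) \<le> 2 * (1 / 2) ^ N - 2 * (1 / 2) ^ k"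
  using assms(2)
proof (induction k rule: dec_induct)
  case (step k)
  have "cmod (a (Suc k) - a N) \<le> cmod (a (Suc k) - a k) + cmod (a k - a N)"
    using norm_triangle_ineq[of "a (Suc k) - a k" "a k - a N"] by simp
  also have "\<dots> \<le> (1 / 2) ^ k + (2 * (1 / 2) ^ N - 2 * (1 / 2) ^ k)"
    using assms(1)[OF step(1)] step.IH by (rule add_mono)
  finally show ?case by simp
qed simp

lemma geometric_limit_bound:
  fixes a :: "nat \<Rightarrow> complex"
  assumes "\<And>i. N \<le> i \<Longrightarrow> cmod (a (Suc i) - a i) \<le> (1 / 2) ^ i" and lim: "a \<longlonglongrightarrow> l"
  shows "cmod (l - a N) \<le> 2 * (1 / 2) ^ N"
proof -
  have "(\<lambda>k. cmod (a k - a N)) \<longlonglongrightarrow> cmod (l - a N)" by (intro tendsto_intros lim)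
  moreover have "\<forall>\<^sub>F k in sequentially. cmod (a k - a N) \<le> 2 * (1 / 2) ^ N"
    using eventually_ge_at_top[of N]
  proof eventually_elim
    case (elim k)
    have "(0 :: real) \<le> 2 * (1 / 2) ^ k" by simp
    with geometric_step_bound[OF assms(1) elim] show ?case by linarith
  qed
  ultimately show ?thesis by (rule tendsto_upperbound) simp
qed

lemma geometric_convergent:
  fixes a :: "nat \<Rightarrow> complex"
  assumes "\<And>i. N \<le> i \<Longrightarrow> cmod (a (Suc i) - a i) \<le> (1 / 2) ^ i"
  shows "convergent a"
proof -
  have "summable (\<lambda>i. a (Suc i) - a i)"
    by (rule summable_comparison_test'[where N = N and g = "\<lambda>i. (1 / 2) ^ i"])
      (use assms in \<open>auto intro: summable_geometric\<close>)
  then have "convergent (\<lambda>n. \<Sum>i<n. a (Suc i) - a i)" by (simp add: summable_iff_convergent)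
  then have "convergent (\<lambda>n. a n - a 0)" by (simp add: sum_lessThan_telescope)
  then show ?thesis by (rule convergent_diff_const_right_iff[THEN iffD1])
qed

text \<open>Uniform convergence on the open sets \<open>dual_ball C n\<close>, which exhaust the dual, gives continuity; as each closed disc
  of a complex line is compact, it lies in one of these sets, which gives holomorphy on lines.\<close>

lemma entire_limit:
  fixes C :: "'f::complex_lcs set" and v :: "nat \<Rightarrow> 'f dual entire"
  assumes C: "compact C"
    and step: "\<And>i j \<phi>. j \<le> i \<Longrightarrow> \<phi> \<in> dual_ball C (real j) \<Longrightarrow>
      cmod (entire_apply (v (Suc i)) \<phi> - entire_apply (v i) \<phi>) \<le> (1 / 2) ^ i"
  shows "\<exists>f. v \<longlonglongrightarrow> f"
proof -
  define f where "f = (\<lambda>\<phi>. lim (\<lambda>i. entire_apply (v i) \<phi>))"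
  have bound: "cmod (f \<phi> - entire_apply (v i) \<phi>) \<le> 2 * (1 / 2) ^ i"
    if "j \<le> i" "\<phi> \<in> dual_ball C (real j)" for i j \<phi>
  proof -
    have s: "cmod (entire_apply (v (Suc k)) \<phi> - entire_apply (v k) \<phi>) \<le> (1 / 2) ^ k" if "i \<le> k" for k
      using step[of j k \<phi>] \<open>j \<le> i\<close> \<open>\<phi> \<in> dual_ball C (real j)\<close> that by simp
    have "(\<lambda>i. entire_apply (v i) \<phi>) \<longlonglongrightarrow> f \<phi>"
      unfolding f_def convergent_LIMSEQ_iff[symmetric] by (rule geometric_convergent[OF s])
    from geometric_limit_bound[OF s this] show ?thesis .
  qed
  have null: "(\<lambda>i. 2 * (1 / 2 :: real) ^ i) \<longlonglongrightarrow> 0"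
    using tendsto_mult_right_zero[OF LIMSEQ_power_zero[of "1 / 2 :: real"], of 2] by simp
  have unif: "uniform_limit (dual_ball C (real j)) (\<lambda>i. entire_apply (v i)) f sequentially" for j
  proof (rule uniform_limitI)
    fix e :: real assume "0 < e"
    with order_tendstoD(2)[OF null] have "\<forall>\<^sub>F i in sequentially. 2 * (1 / 2) ^ i < e" by blast
    then show "\<forall>\<^sub>F i in sequentially. \<forall>\<phi>\<in>dual_ball C (real j). dist (entire_apply (v i) \<phi>) (f \<phi>) < e"
      using eventually_ge_at_top[of j]
    proof eventually_elim
      case (elim i)
      then show ?case using bound[OF elim(2)] by (auto simp: dist_norm norm_minus_commute intro: le_less_trans)
    qed
  qed
  have "continuous_on (\<Union>n. dual_ball C (real (Suc n))) f"
  proof (rule continuous_on_open_UN)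
    show "open (dual_ball C (real (Suc n)))" for n by (intro open_dual_ball C) simp
    show "continuous_on (dual_ball C (real (Suc n))) f" for n
      by (rule uniform_limit_theorem[OF always_eventually unif])
        (simp_all add: continuous_on_subset[OF entire_continuous])
  qed
  moreover have "(\<Union>n. dual_ball C (real (Suc n))) = UNIV" using in_dual_ball[OF C] by blast
  ultimately have cont: "continuous_on UNIV f" by simp
  have hol: "(\<lambda>z. f (a + z *\<^sub>C b)) holomorphic_on UNIV" for a b
  proof (rule holomorphic_uniform_sequence[OF open_UNIV])
    show "(\<lambda>z. entire_apply (v i) (a + z *\<^sub>C b)) holomorphic_on UNIV" for i
      by (rule entire_line_holomorphic)
    fix z :: complex
    have "compact ((\<lambda>z. a + z *\<^sub>C b) ` cball z 1)"
      by (intro compact_continuous_image continuous_intros continuous_on_scaleC compact_cball)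
    then obtain n where n: "(\<lambda>z. a + z *\<^sub>C b) ` cball z 1 \<subseteq> dual_ball C (real n)"
      using compact_subset_dual_ball[OF C] by blast
    have "uniform_limit (cball z 1) (\<lambda>i z. entire_apply (v i) (a + z *\<^sub>C b)) (\<lambda>z. f (a + z *\<^sub>C b)) sequentially"
      by (rule uniform_limit_compose'[OF unif]) (use n in blast)
    then show "\<exists>d>0. cball z d \<subseteq> UNIV \<and>
        uniform_limit (cball z d) (\<lambda>i z. entire_apply (v i) (a + z *\<^sub>C b)) (\<lambda>z. f (a + z *\<^sub>C b)) sequentially"
      by (intro exI[of _ 1]) simp
  qed
  have f: "entire_apply (Abs_entire f) = f" using cont hol by (intro Abs_entire_inverse) simp
  have "v \<longlonglongrightarrow> Abs_entire f"
    unfolding entire.tendsto_rep_iff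
  proof (intro allI impI)
    fix K :: "'f dual set" and e :: real assume "compact K" "0 < e"
    obtain n where n: "K \<subseteq> dual_ball C (real n)" using compact_subset_dual_ball[OF C \<open>compact K\<close>] by blast
    from uniform_limitD[OF unif \<open>0 < e\<close>, of n]
    show "\<forall>\<^sub>F i in sequentially. \<forall>\<phi>\<in>K. cmod (entire_apply (v i) \<phi> - entire_apply (Abs_entire f) \<phi>) < e"
      by eventually_elim (use n in \<open>auto simp: f dist_norm\<close>)
  qed
  then show ?thesis ..
qed

lemma continuous_on_funpow:
  fixes L :: "'a::topological_space \<Rightarrow> 'a"
  assumes "continuous_on UNIV L"
  shows "continuous_on UNIV (L ^^ n)"
proof (induction n)
  case (Suc n)
  then show ?case
    using continuous_on_compose[OF Suc continuous_on_subset[OF assms]] by simp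
qed (simp add: id_def)

text \<open>Two basic neighbourhoods in the compact-open topology contain neighbourhoods that are defined by uniform closeness
  on one common \<open>dual_ball C r\<close>, where \<open>transitivity_step\<close> applies.\<close>

section \<open>Mixing and hypercyclicity\<close>

lemma mixing_if_symbol_small_and_large:
  fixes L :: "'f::{complex_lcs,metric_space} dual entire \<Rightarrow> 'f dual entire"
  assumes AP: "approximation_property TYPE('f)"
    and L: "convolution_operator L" and C: "compact C"
    and D: "closure D = UNIV" "D \<subseteq> bounded_vectors C"
    and a: "a \<in> bounded_vectors C" "cmod (symbol L a) < 1"
    and b: "b \<in> bounded_vectors C" "1 < cmod (symbol L b)"
  shows "mixing L"
  unfolding mixing_def
proof (intro allI impI)
  fix U V :: "'f dual entire set"
  assume U: "open U" "U \<noteq> {}" and V: "open V" "V \<noteq> {}"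
  have "open {x. cmod (symbol L x) < 1}"
    by (intro open_Collect_less continuous_intros continuous_on_symbol[OF L])
  moreover have "{x. cmod (symbol L x) < 1} \<noteq> {}" using a(2) by blast
  ultimately obtain v where v: "v \<in> exp_span (bounded_vectors C \<inter> {x. cmod (symbol L x) < 1})" "v \<in> U"
    using approximable_meets_open[OF exponentials_over_open_set_dense[OF AP C D] U] by blast
  obtain q where q: "q \<in> exp_span (bounded_vectors C \<inter> UNIV)" "q \<in> V"
    using approximable_meets_open[OF exponentials_over_open_set_dense[OF AP C D open_UNIV UNIV_not_empty] V]
    by blast
  then have q_mem: "q \<in> exp_span (bounded_vectors C)" by simp
  obtain K1 e1 where 1: "compact K1" "0 < e1" "{g. \<forall>x\<in>K1. cmod (entire_apply g x - entire_apply v x) < e1} \<subseteq> U"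
    using U(1) v(2) by (rule entire.open_repE)
  obtain K2 e2 where 2: "compact K2" "0 < e2" "{g. \<forall>x\<in>K2. cmod (entire_apply g x - entire_apply q x) < e2} \<subseteq> V"
    using V(1) q(2) by (rule entire.open_repE)
  obtain r where r: "K1 \<union> K2 \<subseteq> dual_ball C (real r)"
    using compact_subset_dual_ball[OF C compact_Un[OF 1(1) 2(1)]] by blast
  have "0 < min e1 e2" using 1(2) 2(2) by simp
  from transitivity_step[OF L C a b v(1) q_mem this, of 0 "real r"]
  obtain n0 where n0: "\<forall>n\<ge>n0. \<exists>v'\<in>exp_span (bounded_vectors C \<inter> {x. cmod (symbol L x) < 1}).
      (\<forall>m\<le>0. \<forall>\<phi>\<in>dual_ball C (real r). cmod (entire_apply ((L ^^ m) (v' - v)) \<phi>) < min e1 e2) \<and>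
      (\<forall>\<phi>\<in>dual_ball C (real r). cmod (entire_apply ((L ^^ n) v' - q) \<phi>) < min e1 e2)" ..
  show "\<exists>n0. \<forall>n\<ge>n0. (L ^^ n) ` U \<inter> V \<noteq> {}"
  proof (intro exI[of _ n0] allI impI)
    fix n assume "n0 \<le> n"
    from n0[rule_format, OF this] obtain v' where
      near: "\<forall>m\<le>0. \<forall>\<phi>\<in>dual_ball C (real r). cmod (entire_apply ((L ^^ m) (v' - v)) \<phi>) < min e1 e2"
      and v'_q: "\<forall>\<phi>\<in>dual_ball C (real r). cmod (entire_apply ((L ^^ n) v' - q) \<phi>) < min e1 e2"
      by (elim bexE conjE)
    have v'_v: "cmod (entire_apply (v' - v) \<phi>) < min e1 e2" if "\<phi> \<in> dual_ball C (real r)" for \<phi>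
      using near[rule_format, OF order_refl that] by simp
    have "v' \<in> U"
    proof (intro subsetD[OF 1(3)] CollectI ballI)
      fix x assume "x \<in> K1"
      then have "x \<in> dual_ball C (real r)" using r by blast
      from v'_v[OF this] show "cmod (entire_apply v' x - entire_apply v x) < e1"
        by (simp add: entire.rep_diff)
    qed
    moreover have "(L ^^ n) v' \<in> V"
    proof (intro subsetD[OF 2(3)] CollectI ballI)
      fix x assume "x \<in> K2"
      then have "x \<in> dual_ball C (real r)" using r by blast
      with v'_q have "cmod (entire_apply ((L ^^ n) v' - q) x) < min e1 e2" by blast
      then show "cmod (entire_apply ((L ^^ n) v') x - entire_apply q x) < e2"
        by (simp add: entire.rep_diff)
    qed
    ultimately show "(L ^^ n) ` U \<inter> V \<noteq> {}" by blast
  qed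
qed

text \<open>Let \<open>q\<close> run through a countable dense set of exponential sums, each of them infinitely often.  Repeated use of
  \<open>transitivity_step\<close> yields exponential sums \<open>v j\<close> and times \<open>n j\<close> such that \<open>(L ^^ n (Suc j)) (v (Suc j))\<close> is
  within \<open>(1 / 2) ^ j\<close> of \<open>q j\<close> on \<open>dual_ball C j\<close>, and such that \<open>(L ^^ m) (v (Suc j) - v j)\<close> is at most \<open>(1 / 2) ^ j\<close> there
  for all \<open>m \<le> n j\<close>.  The second condition preserves the first one, up to a geometric series, in the limit of \<open>v\<close>.\<close>

lemma hypercyclic_if_symbol_small_and_large:
  fixes L :: "'f::{complex_lcs,metric_space} dual entire \<Rightarrow> 'f dual entire"
  assumes AP: "approximation_property TYPE('f)"
    and L: "convolution_operator L" and C: "compact C"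
    and D: "countable D" "closure D = UNIV" "D \<subseteq> bounded_vectors C"
    and a: "a \<in> bounded_vectors C" "cmod (symbol L a) < 1"
    and b: "b \<in> bounded_vectors C" "1 < cmod (symbol L b)"
  shows "hypercyclic L"
proof -
  note lin = clinear_funpow[OF convolution_operatorD(1)[OF L]]
  let ?X = "exp_span (bounded_vectors C \<inter> {x. cmod (symbol L x) < 1})"
  obtain Q where Q: "countable Q" "Q \<subseteq> exp_span D"
    "\<And>f. entire_apply f \<in> uniformly_approximable (Collect compact) (entire_apply ` Q)"
    using countable_dense_exponential_sums[OF AP D(1,2)] by blast
  have Q_ne: "Q \<noteq> {}" using approximable_meets_open[OF Q(3) open_UNIV] by blast
  \<comment> \<open>the first component of \<open>prod_decode\<close> takes every value at arbitrarily large arguments\<close>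
  define q where "q = (\<lambda>j. from_nat_into Q (fst (prod_decode j)))"
  have q_mem: "q j \<in> exp_span (bounded_vectors C)" for j
  proof -
    have "q j \<in> exp_span D" using from_nat_into[OF Q_ne] Q(2) by (auto simp: q_def)
    then show ?thesis
      using complex_vector.span_mono[OF image_mono[OF D(3)]] by blast
  qed
  have q_hits: "\<exists>j\<ge>N. q j = g" if "g \<in> Q" for g N
  proof -
    have "q (prod_encode (to_nat_on Q g, N)) = g"
      using that Q(1) by (simp add: q_def)
    moreover have "N \<le> prod_encode (to_nat_on Q g, N)" by (rule le_prod_encode_2)
    ultimately show ?thesis by blast
  qed
  \<comment> \<open>the pair \<open>s j\<close> consists of the function \<open>v j\<close> and the time \<open>n j\<close>\<close>
  have "\<exists>s. \<forall>j. fst (s j) \<in> ?X \<and> (snd (s j) \<le> snd (s (Suc j)) \<and>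
      (\<forall>m\<le>snd (s j). \<forall>\<phi>\<in>dual_ball C (real j).
        cmod (entire_apply ((L ^^ m) (fst (s (Suc j)) - fst (s j))) \<phi>) < (1 / 2) ^ j) \<and>
      (\<forall>\<phi>\<in>dual_ball C (real j).
        cmod (entire_apply ((L ^^ snd (s (Suc j))) (fst (s (Suc j))) - q j) \<phi>) < (1 / 2) ^ j))"
  proof (rule dependent_nat_choice)
    show "\<exists>p :: 'f dual entire \<times> nat. fst p \<in> ?X"
      by (rule exI[of _ "(0, 0)"]) (simp add: complex_vector.span_zero)
  next
    fix p :: "'f dual entire \<times> nat" and j :: nat
    assume p: "fst p \<in> ?X"
    obtain n0 where n0: "\<And>n. n0 \<le> n \<Longrightarrow> \<exists>v'\<in>?X.
        (\<forall>m\<le>snd p. \<forall>\<phi>\<in>dual_ball C (real j). cmod (entire_apply ((L ^^ m) (v' - fst p)) \<phi>) < (1 / 2) ^ j) \<and>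
        (\<forall>\<phi>\<in>dual_ball C (real j). cmod (entire_apply ((L ^^ n) v' - q j) \<phi>) < (1 / 2) ^ j)"
      using transitivity_step[OF L C a b p q_mem[of j], of "(1 / 2) ^ j" "snd p" "real j"] by auto
    define n where "n = max n0 (snd p)"
    obtain v' where "v' \<in> ?X"
      "\<forall>m\<le>snd p. \<forall>\<phi>\<in>dual_ball C (real j). cmod (entire_apply ((L ^^ m) (v' - fst p)) \<phi>) < (1 / 2) ^ j"
      "\<forall>\<phi>\<in>dual_ball C (real j). cmod (entire_apply ((L ^^ n) v' - q j) \<phi>) < (1 / 2) ^ j"
      using n0[of n] by (auto simp: n_def)
    then show "\<exists>p'. fst p' \<in> ?X \<and> (snd p \<le> snd p' \<and>
      (\<forall>m\<le>snd p. \<forall>\<phi>\<in>dual_ball C (real j).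
        cmod (entire_apply ((L ^^ m) (fst p' - fst p)) \<phi>) < (1 / 2) ^ j) \<and>
      (\<forall>\<phi>\<in>dual_ball C (real j).
        cmod (entire_apply ((L ^^ snd p') (fst p') - q j) \<phi>) < (1 / 2) ^ j))"
      by (intro exI[of _ "(v', n)"]) (simp add: n_def)
  qed
  then obtain s where s: "\<And>j. snd (s j) \<le> snd (s (Suc j))"
    "\<And>j m \<phi>. m \<le> snd (s j) \<Longrightarrow> \<phi> \<in> dual_ball C (real j) \<Longrightarrow>
        cmod (entire_apply ((L ^^ m) (fst (s (Suc j)) - fst (s j))) \<phi>) < (1 / 2) ^ j"
    "\<And>j \<phi>. \<phi> \<in> dual_ball C (real j) \<Longrightarrow>
        cmod (entire_apply ((L ^^ snd (s (Suc j))) (fst (s (Suc j))) - q j) \<phi>) < (1 / 2) ^ j"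
    by blast
  define v where "v = (\<lambda>j. fst (s j))"
  define n where "n = (\<lambda>j. snd (s j))"
  have n_mono: "n i \<le> n j" if "i \<le> j" for i j
    using that s(1) unfolding n_def by (rule lift_Suc_mono_le[rotated])
  have step: "cmod (entire_apply ((L ^^ m) (v (Suc j))) \<phi> - entire_apply ((L ^^ m) (v j)) \<phi>) \<le> (1 / 2) ^ j"
    if "m \<le> n j" "i \<le> j" "\<phi> \<in> dual_ball C (real i)" for m i j \<phi>
  proof -
    have "\<phi> \<in> dual_ball C (real j)"
      using that(2,3) dual_ball_mono[of "real i" "real j" C] by auto
    then have "cmod (entire_apply ((L ^^ m) (v (Suc j) - v j)) \<phi>) < (1 / 2) ^ j"
      using s(2) that(1) unfolding v_def n_def by blast
    then show ?thesis by (simp add: clinear_diff[OF lin] entire.rep_diff)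
  qed
  obtain f where f: "v \<longlonglongrightarrow> f"
    using entire_limit[OF C, of v] step[of 0] by auto
  have close: "cmod (entire_apply ((L ^^ n (Suc j)) f) \<phi> - entire_apply (q j) \<phi>) \<le> 2 * (1 / 2) ^ j"
    if "\<phi> \<in> dual_ball C (real j)" for j \<phi>
  proof -
    let ?m = "n (Suc j)"
    have "(\<lambda>i. (L ^^ ?m) (v i)) \<longlonglongrightarrow> (L ^^ ?m) f"
      by (rule continuous_on_tendsto_compose[OF continuous_on_funpow[OF convolution_operatorD(2)[OF L]] f]) auto
    then have lim: "(\<lambda>i. entire_apply ((L ^^ ?m) (v i)) \<phi>) \<longlonglongrightarrow> entire_apply ((L ^^ ?m) f) \<phi>"
      by (rule entire.tendsto_evaluation)
    have "cmod (entire_apply ((L ^^ ?m) f) \<phi> - entire_apply ((L ^^ ?m) (v (Suc j))) \<phi>) \<le> 2 * (1 / 2) ^ Suc j"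
    proof (rule geometric_limit_bound[OF _ lim])
      fix i assume "Suc j \<le> i"
      then show "cmod (entire_apply ((L ^^ ?m) (v (Suc i))) \<phi> - entire_apply ((L ^^ ?m) (v i)) \<phi>) \<le> (1 / 2) ^ i"
        using that by (intro step[of _ _ j] n_mono) auto
    qed
    moreover have "cmod (entire_apply ((L ^^ ?m) (v (Suc j))) \<phi> - entire_apply (q j) \<phi>) < (1 / 2) ^ j"
      using s(3)[OF that] unfolding v_def n_def by (simp add: entire.rep_diff)
    ultimately show ?thesis
      using norm_diff_triangle_ineq[of "entire_apply ((L ^^ ?m) f) \<phi>" "entire_apply ((L ^^ ?m) (v (Suc j))) \<phi>"
          "entire_apply ((L ^^ ?m) (v (Suc j))) \<phi>" "entire_apply (q j) \<phi>"] by simp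
  qed
  have "V \<inter> range (\<lambda>n. (L ^^ n) f) \<noteq> {}" if V: "open V" "g \<in> V" for V g
  proof -
    obtain K e where K: "compact K" "0 < e" "{h. \<forall>x\<in>K. cmod (entire_apply h x - entire_apply g x) < e} \<subseteq> V"
      using V by (rule entire.open_repE)
    have e2: "0 < e / 2" using K(2) by simp
    obtain h where h: "h \<in> Q" "\<And>x. x \<in> K \<Longrightarrow> cmod (entire_apply g x - entire_apply h x) < e / 2"
      using approximable_imageE[OF Q(3)[of g] _ e2, of K] K(1) by blast
    obtain r where r: "K \<subseteq> dual_ball C (real r)" using compact_subset_dual_ball[OF C K(1)] by blast
    obtain N where N: "(1 / 2) ^ N < e / 4"
      using real_arch_pow_inv[of "e / 4" "1 / 2"] K(2) by auto
    obtain j where j: "max r N \<le> j" "q j = h" using q_hits[OF h(1)] by blast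
    have "(1 / 2 :: real) ^ j \<le> (1 / 2) ^ N" using j(1) by (intro power_decreasing) auto
    with N have small: "2 * (1 / 2) ^ j < e / 2" by linarith
    have "(L ^^ n (Suc j)) f \<in> V"
    proof (intro subsetD[OF K(3)] CollectI ballI)
      fix x assume x: "x \<in> K"
      then have "x \<in> dual_ball C (real j)"
        using r j(1) dual_ball_mono[of "real r" "real j" C] by auto
      from close[OF this] have "cmod (entire_apply ((L ^^ n (Suc j)) f) x - entire_apply h x) < e / 2"
        using small j(2) by simp
      then show "cmod (entire_apply ((L ^^ n (Suc j)) f) x - entire_apply g x) < e"
        using h(2)[OF x] norm_triangle_ineq4[of "entire_apply ((L ^^ n (Suc j)) f) x - entire_apply h x"
            "entire_apply g x - entire_apply h x"] by simp
    qed
    then show ?thesis by blast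
  qed
  then have "g \<in> closure (range (\<lambda>n. (L ^^ n) f))" for g
    using closure_iff_nhds_not_empty[of g "range (\<lambda>n. (L ^^ n) f)"] by blast
  then show ?thesis unfolding hypercyclic_def by blast
qed

theorem theorem4p1:
  fixes L :: "'f::complex_frechet dual entire \<Rightarrow> 'f dual entire"
  assumes "separable_space (euclidean :: 'f topology)"
    and "approximation_property TYPE('f)"
    and "convolution_operator L"
    and "nontrivial_operator L"
  shows "mixing L \<and> hypercyclic L"
proof -
  obtain D :: "'f set" where D: "countable D" "closure D = UNIV"
    using assms(1) unfolding separable_space_def by auto
  obtain C where C: "compact C" "D \<subseteq> bounded_vectors C"
    using countable_subset_bounded_vectors[OF D(1)] by blast
  have cont: "continuous_on UNIV (\<lambda>x. cmod (symbol L x))"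
    by (intro continuous_intros continuous_on_symbol[OF assms(3)])
  obtain a0 b0 where ab0: "cmod (symbol L a0) < 1" "1 < cmod (symbol L b0)"
    using symbol_small_and_large[OF assms(2-4)] by blast
  have "open {x. cmod (symbol L x) < 1}" by (intro open_Collect_less cont continuous_intros)
  then have "\<forall>\<^sub>F x in nhds a0. x \<in> {x. cmod (symbol L x) < 1}"
    by (rule eventually_nhds_in_open) (use ab0(1) in simp)
  from dense_eventually[OF D(2) this] obtain a where "a \<in> D" and a: "cmod (symbol L a) < 1" by blast
  have "open {x. 1 < cmod (symbol L x)}" by (intro open_Collect_less cont continuous_intros)
  then have "\<forall>\<^sub>F x in nhds b0. x \<in> {x. 1 < cmod (symbol L x)}"
    by (rule eventually_nhds_in_open) (use ab0(2) in simp)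
  from dense_eventually[OF D(2) this] obtain b where "b \<in> D" and b: "1 < cmod (symbol L b)" by blast
  have ab: "a \<in> bounded_vectors C" "b \<in> bounded_vectors C"
    using \<open>a \<in> D\<close> \<open>b \<in> D\<close> C(2) by blast+
  show ?thesis
    using mixing_if_symbol_small_and_large[OF assms(2,3) C(1) D(2) C(2) ab(1) a ab(2) b]
      hypercyclic_if_symbol_small_and_large[OF assms(2,3) C(1) D C(2) ab(1) a ab(2) b] ..
qed

end
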